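(* Let $\Psi:\overline{\mathbb D}\to\overline{\mathbb D}$ be a homeomorphism with identity boundary values ($\Psi|_{\mathbb T}=\operatorname{id}_{\mathbb T}$) and a uniform boundary expansion of first order, with coefficient $v_\Psi:\mathbb T\to\mathbb C$, and set $a_\Psi(\zeta)=\operatorname{Re}(\overline\zeta\,v_\Psi(\zeta))$. Then $\Psi$ is differentiable at every $\zeta\in\mathbb T$ relative to $\overline{\mathbb D}$, with real linear differential $$D_\partial\Psi(\zeta)[h]=h+\operatorname{Re}(\overline\zeta h)\bigl(v_\Psi(\zeta)-\zeta\bigr),\qquad h\in\mathbb C.$$ The following conditions are equivalent: (i) $\Psi|_{\mathbb D}\in\mathcal K_{\mathrm c}$. (ii) $\inf_{\zeta\in\mathbb T}a_\Psi(\zeta)>0$. (iii) $\det D_\partial\Psi(\zeta)>0$ for every $\zeta\in\mathbb T$. Moreover, $$\lim_{r\uparrow1}\sup_{\zeta\in\mathbb T}\left|\frac{1-|\Psi(r\zeta)|^2}{1-r^2}-a_\Psi(\zeta)\right|=0.$$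
   Context: $\mathbb D=\{z\in\mathbb C:|z|<1\}$, $\mathbb T=\partial\mathbb D$, and $\rho(z,w)=\left|\frac{z-w}{1-\overline z w}\right|$ is the pseudohyperbolic metric. Differentials are real, with $\mathbb C$ identified with $\mathbb R^2$. The notation $A(z)\asymp B(z)$ means that there are constants $0<c\le C<\infty$, independent of $z$ (possibly depending on the map), with $cB\le A\le CB$. Uniform boundary expansion: a continuous $\Psi:\overline{\mathbb D}\to\overline{\mathbb D}$ with identity boundary values has a uniform boundary expansion of first order if there is a continuous map $v_\Psi:\mathbb T\to\mathbb C$ (necessarily unique) such that $$\lim_{t\downarrow0}\sup_{\zeta\in\mathbb T}\frac{|\Psi((1-t)\zeta)-\zeta+t\,v_\Psi(\zeta)|}{t}=0.$$ Differentiability at $\zeta\in\mathbb T$ relative to $\overline{\mathbb D}$ with real linear differential $D_\partial\Psi(\zeta)$ means $|\Psi(z)-\Psi(\zeta)-D_\partial\Psi(\zeta)[z-\zeta]|/|z-\zeta|\to0$ as $z\to\zeta$, $z\in\overline{\mathbb D}$. Sequences are indexed families $\Lambda=(\lambda_j)$ (finite or countably infinite) of points of $\mathbb D$; the image $\Phi(\Lambda)=(\Phi(\lambda_j))$ retains repeated terms. $\mathcal C$ denotes the class of Carleson (interpolating) sequences: $\Lambda=(\lambda_j)\in\mathcal C$ if every bounded scalar sequence $(a_j)$ is of the form $a_j=f(\lambda_j)$ for some $f\in H^\infty(\mathbb D)$. Finite sequences of distinct points belong to $\mathcal C$; a sequence with a repeated term does not. $\mathcal C_{\leftrightarrow}^{\mathrm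 c}$ is the class of continuous maps $\Phi:\mathbb D\to\mathbb D$ such that for every indexed sequence $\Lambda\subset\mathbb D$, $\Lambda\in\mathcal C\Leftrightarrow\Phi(\Lambda)\in\mathcal C$. $\mathcal P_{\mathrm c}=\{\Phi\in\mathcal C_{\leftrightarrow}^{\mathrm c}:1-|\Phi(z)|^2\asymp1-|z|^2\text{ for }z\in\mathbb D\}$. Every $\Phi\in\mathcal P_{\mathrm c}$ is a homeomorphism of $\mathbb D$ extending uniquely to a homeomorphism of $\overline{\mathbb D}$; $h_\Phi$ is the restriction of the extension to $\mathbb T$. $\mathcal K_{\mathrm c}=\{\Phi\in\mathcal P_{\mathrm c}:h_\Phi=\operatorname{id}_{\mathbb T}\}$. *)

theory Defs
  imports "HOL-Complex_Analysis.Complex_Analysis"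
begin

text \<open>Maps of the disc or of the closed disc are total functions on the complex numbers; every
  notion below only looks at their values on the relevant set.\<close>

abbreviation unit_disc :: "complex set" where
  "unit_disc \<equiv> ball 0 1"

abbreviation closed_disc :: "complex set" where
  "closed_disc \<equiv> cball 0 1"

abbreviation unit_circ :: "complex set" where
  "unit_circ \<equiv> sphere 0 1"

definition H_infinity :: "(complex \<Rightarrow> complex) set" where
  "H_infinity = {f. f holomorphic_on unit_disc \<and> bounded (f ` unit_disc)}"

text \<open>A finite or countably infinite family is a function on \<^typ>\<open>nat\<close> together with an arbitrary
  index set \<open>I\<close>; values off \<open>I\<close> are ignored. Terms may repeat. Only the cardinality of the index
  set matters for interpolation, so subsets of \<^typ>\<open>nat\<close> suffice.\<close>

definition carleson_seq :: "nat set \<Rightarrow> (nat \<Rightarrow> complex) \<Rightarrow> bool" where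
  "carleson_seq I lam \<longleftrightarrow> lam ` I \<subseteq> unit_disc \<and>
     (\<forall>a :: nat \<Rightarrow> complex. bounded (a ` I) \<longrightarrow>
        (\<exists>f \<in> H_infinity. \<forall>j\<in>I. f (lam j) = a j))"

definition carleson_biinvariant :: "(complex \<Rightarrow> complex) set" where
  "carleson_biinvariant = {\<Phi>. continuous_on unit_disc \<Phi> \<and> \<Phi> ` unit_disc \<subseteq> unit_disc \<and>
     (\<forall>I lam. lam ` I \<subseteq> unit_disc \<longrightarrow>
        (carleson_seq I lam \<longleftrightarrow> carleson_seq I (\<lambda>j. \<Phi> (lam j))))}"

definition P_class :: "(complex \<Rightarrow> complex) set" where
  "P_class = {\<Phi> \<in> carleson_biinvariant.
     \<exists>c C. 0 < c \<and> c \<le> C \<and>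
       (\<forall>z\<in>unit_disc. c * (1 - (cmod z)\<^sup>2) \<le> 1 - (cmod (\<Phi> z))\<^sup>2 \<and>
                        1 - (cmod (\<Phi> z))\<^sup>2 \<le> C * (1 - (cmod z)\<^sup>2))}"

definition disc_extension :: "(complex \<Rightarrow> complex) \<Rightarrow> (complex \<Rightarrow> complex) \<Rightarrow> bool" where
  "disc_extension \<Phi> E \<longleftrightarrow> (\<exists>E'. homeomorphism closed_disc closed_disc E E') \<and>
     (\<forall>z\<in>unit_disc. E z = \<Phi> z)"

text \<open>By density of the disc, \<open>\<Phi>\<close> has at most one extension up to values off the closed disc,
  so the existential quantifier below says that the boundary map of \<open>\<Phi>\<close> is the identity.\<close>

definition K_class :: "(complex \<Rightarrow> complex) set" where
  "K_class = {\<Phi> \<in> P_class. \<exists>E. disc_extension \<Phi> E \<and> (\<forall>\<zeta>\<in>unit_circ. E \<zeta> = \<zeta>)}"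

text \<open>For \<open>t\<close> in \<open>(0,1]\<close> the supremum is that of a continuous function on the compact circle,
  so the real-valued \<open>SUP\<close> is a genuine supremum near \<open>t = 0\<close>.\<close>

definition uniform_boundary_expansion ::
    "(complex \<Rightarrow> complex) \<Rightarrow> (complex \<Rightarrow> complex) \<Rightarrow> bool" where
  "uniform_boundary_expansion \<Psi> v \<longleftrightarrow>
     continuous_on closed_disc \<Psi> \<and> \<Psi> ` closed_disc \<subseteq> closed_disc \<and>
     (\<forall>\<zeta>\<in>unit_circ. \<Psi> \<zeta> = \<zeta>) \<and>
     continuous_on unit_circ v \<and>
     ((\<lambda>t::real. SUP \<zeta>\<in>unit_circ.
         cmod (\<Psi> (of_real (1 - t) * \<zeta>) - \<zeta> + of_real t * v \<zeta>) / t) \<longlongrightarrow> 0) (at_right 0)"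

definition boundary_coeff :: "(complex \<Rightarrow> complex) \<Rightarrow> complex \<Rightarrow> real" where
  "boundary_coeff v \<zeta> = Re (cnj \<zeta> * v \<zeta>)"

text \<open>The derivative within the closed disc is unique at boundary points too, since the disc
  approaches each of them along two linearly independent directions.\<close>

definition boundary_differential :: "(complex \<Rightarrow> complex) \<Rightarrow> complex \<Rightarrow> complex \<Rightarrow> complex" where
  "boundary_differential \<Psi> \<zeta> = frechet_derivative \<Psi> (at \<zeta> within closed_disc)"

definition real_det :: "(complex \<Rightarrow> complex) \<Rightarrow> real" where
  "real_det L = det (matrix (\<lambda>x :: real^2.
     (let w = L (Complex (x $ 1) (x $ 2)) in vector [Re w, Im w] :: real^2)))"

end

theory Submission
  imports Defs
begin

text \<open>
  Near the circle \<open>\<Psi>\<close> is, up to an error that is small compared with the distance to the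
  circle, the map \<open>(1 - t) \<zeta> \<mapsto> \<zeta> - t v(\<zeta>)\<close>. This makes \<open>\<Psi>\<close> strictly differentiable at each
  boundary point \<open>\<zeta>\<close>: for \<open>z\<close> and \<open>w\<close> near \<open>\<zeta>\<close>, the difference \<open>\<Psi> z - \<Psi> w\<close> equals
  \<open>D (z - w)\<close> up to a small multiple of \<open>(1 - |z|) + (1 - |w|) + |z - w|\<close>, where
  \<open>D h = h + Re (cnj \<zeta> h) (v \<zeta> - \<zeta>)\<close> (lemma \<open>strict_differential\<close>). Taking \<open>w = \<zeta>\<close> gives the
  differential. \<open>D\<close> is a rank one perturbation of the identity with determinant
  \<open>a(\<zeta>) = Re (cnj \<zeta> v(\<zeta>))\<close>, and expanding \<open>|\<zeta> - t v(\<zeta>)|\<^sup>2\<close> gives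
  \<open>1 - |\<Psi> ((1 - t) \<zeta>)|\<^sup>2 = 2 t a(\<zeta>) + o(t)\<close>. So the limit formula holds, a positive
  infimum of \<open>a\<close> means a positive determinant everywhere because a continuous function on the circle
  attains its infimum, and the lower modulus bound in the definition of \<open>P_class\<close> forces \<open>a\<close> to be
  bounded below by a positive constant.

  The substance is that positivity of \<open>a\<close> puts \<open>\<Psi>\<close> into \<open>K_class\<close>. If \<open>a > 0\<close>, then \<open>1 - |\<Psi> z|\<^sup>2\<close> is comparable to
  \<open>1 - |z|\<^sup>2\<close>, the displacement \<open>|\<Psi> z - z|\<close> is at most a multiple of \<open>1 - |z|\<^sup>2\<close>, and, as each
  \<open>D\<close> is invertible, two points are close at the scale of their distance to the circle exactly when
  their images are (lemmas \<open>image_close_if_close\<close> and \<open>close_if_image_close\<close>). Interpolating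
  sequences are handled through Carleson's characterisation (\<open>carleson_interpolation\<close>) by two
  conditions: the points are uniformly separated in the pseudohyperbolic metric \<open>\<rho>\<close>, and the sums
  \<open>\<Sum>k. 1 - \<rho>(\<lambda>\<^sub>j, \<lambda>\<^sub>k)\<^sup>2\<close> are bounded. Since
  \<open>1 - \<rho>(z, w)\<^sup>2 = (1 - |z|\<^sup>2) (1 - |w|\<^sup>2) / |1 - cnj z w|\<^sup>2\<close>, each factor of a summand changes only
  by a bounded factor under \<open>\<Psi>\<close>, so the second condition is preserved in both directions; the first
  is preserved by the two closeness lemmas.

  In Carleson's characterisation, necessity combines a Baire category argument, which yields a
  uniform bound for the interpolating functions, with division by Blaschke factors. Sufficiency uses
  P. Jones's explicit interpolation formula for finite families (\<open>jones_interpolation\<close>), whose bound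
  is independent of the number of points, and a normal family argument.
\<close>

section \<open>The pseudohyperbolic metric\<close>

definition pdist :: "complex \<Rightarrow> complex \<Rightarrow> real" where
  "pdist z w = cmod ((z - w) / (1 - cnj z * w))"

text \<open>The squared modulus of the inner product of the normalised Szego (reproducing) kernels
  of the Hardy space at \<open>z\<close> and \<open>w\<close>.\<close>
definition szego_corr :: "complex \<Rightarrow> complex \<Rightarrow> real" where
  "szego_corr z w = (1 - (cmod z)\<^sup>2) * (1 - (cmod w)\<^sup>2) / (cmod (1 - cnj z * w))\<^sup>2"

definition pd_separated :: "nat set \<Rightarrow> (nat \<Rightarrow> complex) \<Rightarrow> bool" where
  "pd_separated I lam \<longleftrightarrow> (\<exists>\<delta>>0. \<forall>j\<in>I. \<forall>k\<in>I. j \<noteq> k \<longrightarrow> \<delta> \<le> pdist (lam j) (lam k))"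

text \<open>Every finite subfamily is tested with one constant, so that no convergence of infinite
  sums has to be discussed. The term \<open>k = j\<close> may occur; it equals 1.\<close>
definition corr_bounded :: "nat set \<Rightarrow> (nat \<Rightarrow> complex) \<Rightarrow> bool" where
  "corr_bounded I lam \<longleftrightarrow>
     (\<exists>M. \<forall>j\<in>I. \<forall>F. finite F \<longrightarrow> F \<subseteq> I \<longrightarrow> (\<Sum>k\<in>F. szego_corr (lam j) (lam k)) \<le> M)"

lemma cmod_one_minus_cnj_mult:
  "(cmod (1 - cnj z * w))\<^sup>2 = (cmod (z - w))\<^sup>2 + (1 - (cmod z)\<^sup>2) * (1 - (cmod w)\<^sup>2)"
  unfolding cmod_power2 by (simp add: power2_eq_square algebra_simps)

lemma one_minus_cnj_mult_nonzero:
  assumes "z \<in> unit_disc" "cmod w \<le> 1"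
  shows "1 - cnj z * w \<noteq> 0"
proof
  assume "1 - cnj z * w = 0"
  hence "cmod z * cmod w = 1" by (metis complex_mod_cnj eq_iff_diff_eq_0 norm_mult norm_one)
  moreover have "cmod z * cmod w \<le> cmod z" using assms by (simp add: mult_left_le)
  ultimately show False using assms by simp
qed

lemma one_minus_cmod_sq_pos: "z \<in> unit_disc \<Longrightarrow> 0 < 1 - (cmod z)\<^sup>2"
  by (simp add: abs_square_less_1)

lemma one_minus_cmod_le: "cmod z \<le> 1 \<Longrightarrow> 1 - cmod z \<le> 1 - (cmod z)\<^sup>2"
  by (simp add: power2_eq_square mult_left_le)

lemma one_minus_cmod_sq_le: "cmod z \<le> 1 \<Longrightarrow> 1 - (cmod z)\<^sup>2 \<le> 2 * (1 - cmod z)"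
  using sum_squares_bound[of 1 "cmod z"] by simp

lemma pdist_nonneg [simp]: "0 \<le> pdist z w"
  by (simp add: pdist_def)

lemma cmod_one_minus_cnj_commute: "cmod (1 - cnj z * w) = cmod (1 - cnj w * z)"
proof -
  have "cmod (1 - cnj z * w) = cmod (cnj (1 - cnj z * w))" by (simp only: complex_mod_cnj)
  thus ?thesis by (simp add: mult.commute)
qed

lemma pdist_commute: "pdist z w = pdist w z"
  using cmod_one_minus_cnj_commute[of z w] by (simp add: pdist_def norm_divide norm_minus_commute)

lemma szego_corr_eq:
  assumes "z \<in> unit_disc" "w \<in> unit_disc"
  shows "szego_corr z w = 1 - (pdist z w)\<^sup>2"
proof -
  have "(cmod (1 - cnj z * w))\<^sup>2 \<noteq> 0" using one_minus_cnj_mult_nonzero[of z w] assms by simp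
  thus ?thesis using cmod_one_minus_cnj_mult[of z w]
    by (simp add: szego_corr_def pdist_def norm_divide power_divide field_simps)
qed

lemma szego_corr_pos: "z \<in> unit_disc \<Longrightarrow> w \<in> unit_disc \<Longrightarrow> 0 < szego_corr z w"
  using one_minus_cmod_sq_pos[of z] one_minus_cmod_sq_pos[of w] one_minus_cnj_mult_nonzero[of z w]
  by (simp add: szego_corr_def)

lemma pdist_le_1: "z \<in> unit_disc \<Longrightarrow> w \<in> unit_disc \<Longrightarrow> pdist z w \<le> 1"
  using szego_corr_pos[of z w] szego_corr_eq[of z w] power2_le_imp_le[of "pdist z w" 1] by simp

lemma pdist_eq_0_iff: "z \<in> unit_disc \<Longrightarrow> w \<in> unit_disc \<Longrightarrow> pdist z w = 0 \<longleftrightarrow> z = w"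
  using one_minus_cnj_mult_nonzero[of z w] by (simp add: pdist_def)

section \<open>Necessity in Carleson's interpolation theorem\<close>

text \<open>Moving the zero \<open>w\<close> to the origin by a Moebius map reduces this to the Schwarz lemma.
  That lemma asks for values in the open disc, which division by any \<open>M' > M\<close> provides.\<close>
lemma schwarz_pick_zero:
  assumes f: "f holomorphic_on unit_disc" and M: "\<And>z. z \<in> unit_disc \<Longrightarrow> cmod (f z) \<le> M"
    and w: "w \<in> unit_disc" "f w = 0" and z: "z \<in> unit_disc"
  shows "cmod (f z) \<le> M * pdist z w"
proof -
  have M0: "0 \<le> M" using M[OF z] norm_ge_zero order_trans by blast
  have *: "cmod (f z) \<le> M' * pdist z w" if "M < M'" for M'
  proof -
    define g where "g = (\<lambda>u. f (Moebius_function 0 (-w) u) / of_real M')"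
    have M'0: "0 < M'" using that M0 by simp
    have im: "Moebius_function 0 (-w) ` unit_disc \<subseteq> unit_disc"
      using Moebius_function_norm_lt_1[of "-w"] w by auto
    have "(f \<circ> Moebius_function 0 (-w)) holomorphic_on unit_disc"
      by (rule holomorphic_on_compose_gen[OF Moebius_function_holomorphic f im]) (use w in auto)
    hence "g holomorphic_on unit_disc"
      unfolding g_def o_def using M'0 by (intro holomorphic_intros) auto
    moreover have "g 0 = 0" using w by (simp add: g_def Moebius_function_of_zero)
    moreover have "cmod (g u) < 1" if "cmod u < 1" for u
    proof -
      have "Moebius_function 0 (-w) u \<in> unit_disc" using im that by (auto simp: image_subset_iff)
      hence "cmod (f (Moebius_function 0 (-w) u)) < M'" using M \<open>M < M'\<close> by fastforce
      thus ?thesis using M'0 by (simp add: g_def norm_divide)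
    qed
    moreover have "cmod (Moebius_function 0 w z) < 1"
      using Moebius_function_norm_lt_1[of w z] w z by simp
    ultimately have "cmod (g (Moebius_function 0 w z)) \<le> cmod (Moebius_function 0 w z)"
      by (rule Schwarz_Lemma(1))
    moreover have "Moebius_function 0 (-w) (Moebius_function 0 w z) = z"
      using w z by (intro Moebius_function_compose) auto
    moreover have "cmod (Moebius_function 0 w z) = pdist z w"
      by (subst pdist_commute) (simp add: pdist_def Moebius_function_simple norm_divide norm_minus_commute)
    ultimately show ?thesis using M'0 by (simp add: g_def norm_divide field_simps)
  qed
  have "((\<lambda>M'. M' * pdist z w) \<longlongrightarrow> M * pdist z w) (at_right M)"
    by (intro tendsto_intros)
  thus ?thesis
    by (rule tendsto_lowerbound) (use * in \<open>auto simp: eventually_at_filter\<close>)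
qed

text \<open>Zeros are divided out one at a time: by \<open>schwarz_pick_zero\<close>, division by a Blaschke
  factor does not increase the bound \<open>M\<close>.\<close>
lemma schwarz_pick_zeros:
  assumes "finite F" "F \<subseteq> unit_disc"
    and "f holomorphic_on unit_disc" "\<And>z. z \<in> unit_disc \<Longrightarrow> cmod (f z) \<le> M"
    and "\<And>w. w \<in> F \<Longrightarrow> f w = 0" and z: "z \<in> unit_disc"
  shows "cmod (f z) \<le> M * (\<Prod>w\<in>F. pdist z w)"
  using assms(1-5)
proof (induction F arbitrary: f rule: finite_induct)
  case empty
  thus ?case using z by simp
next
  case (insert w F)
  have w: "w \<in> unit_disc" "f w = 0" using insert.prems by auto
  define q where "q = (\<lambda>u. if u = w then deriv f w else (f u - f w) / (u - w))"
  define h where "h = (\<lambda>u. q u * (1 - cnj w * u))"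
  have holh: "h holomorphic_on unit_disc"
    unfolding h_def q_def
    by (intro holomorphic_intros pole_lemma_open insert.prems) auto
  have fh: "cmod (f u) = cmod (h u) * pdist u w" if "u \<in> unit_disc" for u
    using w one_minus_cnj_mult_nonzero[of w u] that
    by (subst pdist_commute) (simp add: h_def q_def pdist_def norm_mult norm_divide norm_minus_commute)
  have hM: "cmod (h u) \<le> M" if u: "u \<in> unit_disc" "u \<noteq> w" for u
  proof -
    have "cmod (h u) * pdist u w \<le> M * pdist u w"
      using schwarz_pick_zero[OF insert.prems(2,3) w u(1)] fh[OF u(1)] by simp
    moreover have "0 < pdist u w" using pdist_eq_0_iff[of u w] u w pdist_nonneg[of u w] by linarith
    ultimately show ?thesis by simp
  qed
  have "cmod (h w) \<le> M"
  proof -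
    have "(h \<longlongrightarrow> h w) (at w)"
      using holomorphic_on_imp_continuous_on[OF holh] w(1)
      by (simp add: continuous_on_eq_continuous_at isCont_def)
    moreover have "\<forall>\<^sub>F u in at w. cmod (h u) \<le> M"
      using eventually_at_in_open[OF open_ball w(1)]
      by (rule eventually_mono) (auto intro: hM)
    ultimately show ?thesis by (intro Lim_norm_ubound[of "at w"]) auto
  qed
  hence "cmod (h u) \<le> M" if "u \<in> unit_disc" for u using hM that by blast
  moreover have "h u = 0" if "u \<in> F" for u
    using that insert w by (auto simp: h_def q_def)
  ultimately have "cmod (h z) \<le> M * (\<Prod>w\<in>F. pdist z w)"
    using insert.IH[of h] insert.prems holh by auto
  hence "cmod (h z) * pdist z w \<le> M * (\<Prod>w\<in>F. pdist z w) * pdist z w"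
    by (rule mult_right_mono) simp
  thus ?case using fh[OF z] insert.hyps by (simp add: mult_ac)
qed

text \<open>Montel's theorem with the bound kept for the limit function.\<close>
lemma bounded_holomorphic_subseq:
  fixes F :: "nat \<Rightarrow> complex \<Rightarrow> complex"
  assumes hol: "\<And>n. F n holomorphic_on unit_disc"
    and bd: "\<And>n z. z \<in> unit_disc \<Longrightarrow> cmod (F n z) \<le> M"
  shows "\<exists>g r. g holomorphic_on unit_disc \<and> (\<forall>z\<in>unit_disc. cmod (g z) \<le> M) \<and>
    strict_mono (r :: nat \<Rightarrow> nat) \<and> (\<forall>z\<in>unit_disc. (\<lambda>n. F (r n) z) \<longlonglongrightarrow> g z)"
proof -
  let ?H = "{h. h holomorphic_on unit_disc \<and> (\<forall>z\<in>unit_disc. cmod (h z) \<le> M)}"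
  obtain g r where g: "g holomorphic_on unit_disc" "strict_mono (r :: nat \<Rightarrow> nat)"
      "\<And>z. z \<in> unit_disc \<Longrightarrow> (\<lambda>n. F (r n) z) \<longlonglongrightarrow> g z"
  proof (rule Montel[of unit_disc ?H F])
    show "\<exists>B. \<forall>h\<in>?H. \<forall>z\<in>K. cmod (h z) \<le> B" if "K \<subseteq> unit_disc" for K
      using that by (intro exI[of _ M]) blast
    show "range F \<subseteq> ?H" using hol bd by auto
  qed auto
  have "cmod (g z) \<le> M" if "z \<in> unit_disc" for z
    by (rule Lim_norm_ubound[OF _ g(3)[OF that]]) (use bd[OF that] in \<open>auto intro: always_eventually\<close>)
  thus ?thesis using g by blast
qed

lemma complete_bounded_sequences: "complete (UNIV :: (nat \<Rightarrow>\<^sub>C complex) set)"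
proof (rule completeI)
  fix a :: "nat \<Rightarrow> nat \<Rightarrow>\<^sub>C complex" assume a: "Cauchy a"
  have "uniformly_Cauchy_on UNIV (\<lambda>n. apply_bcontfun (a n))"
    using a unfolding uniformly_Cauchy_on_def Cauchy_def
    by (meson dist_fun_lt_imp_dist_val_lt)
  hence "uniformly_convergent_on UNIV (\<lambda>n. apply_bcontfun (a n))"
    by (rule Cauchy_uniformly_convergent)
  then obtain g where "uniform_limit UNIV (\<lambda>n. apply_bcontfun (a n)) g sequentially"
    unfolding uniformly_convergent_on_def by blast
  from uniform_limit_bcontfunE[OF this sequentially_bot]
  show "\<exists>l\<in>UNIV. a \<longlonglongrightarrow> l" by (metis UNIV_I)
qed

text \<open>The bounded sequences that are interpolated by a function of norm at most \<open>N\<close> form a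
  closed set (normal families), and these sets exhaust the complete space of all bounded sequences.
  By Baire, one of them contains a ball, and differences of two elements of this ball yield all
  coordinate sequences up to one common factor.\<close>
lemma carleson_seq_uniform_dual:
  assumes "carleson_seq I lam"
  obtains M where "0 < M"
    "\<And>j. j \<in> I \<Longrightarrow> \<exists>f. f holomorphic_on unit_disc \<and> (\<forall>z\<in>unit_disc. cmod (f z) \<le> M) \<and>
        f (lam j) = 1 \<and> (\<forall>k\<in>I. k \<noteq> j \<longrightarrow> f (lam k) = 0)"
proof -
  define E where "E = (\<lambda>N::nat. {a :: nat \<Rightarrow>\<^sub>C complex. \<exists>f. f holomorphic_on unit_disc \<and>
      (\<forall>z\<in>unit_disc. cmod (f z) \<le> real N) \<and> (\<forall>j\<in>I. f (lam j) = apply_bcontfun a j)})"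
  have lam: "\<And>j. j \<in> I \<Longrightarrow> lam j \<in> unit_disc" using assms by (auto simp: carleson_seq_def)
  have closed: "closed (E N)" for N
  proof (subst closed_sequential_limits, intro allI impI, elim conjE)
    fix x l assume x: "\<forall>n. x n \<in> E N" and l: "x \<longlonglongrightarrow> l"
    obtain f where "\<forall>n. f n holomorphic_on unit_disc \<and> (\<forall>z\<in>unit_disc. cmod (f n z) \<le> real N) \<and>
        (\<forall>j\<in>I. f n (lam j) = apply_bcontfun (x n) j)"
      using choice[OF x[unfolded E_def mem_Collect_eq]] ..
    hence f: "\<And>n. f n holomorphic_on unit_disc"
        "\<And>n z. z \<in> unit_disc \<Longrightarrow> cmod (f n z) \<le> real N"
        "\<And>n j. j \<in> I \<Longrightarrow> f n (lam j) = apply_bcontfun (x n) j"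
      by blast+
    obtain g r where g: "g holomorphic_on unit_disc" "\<forall>z\<in>unit_disc. cmod (g z) \<le> real N"
        "strict_mono (r :: nat \<Rightarrow> nat)" "\<forall>z\<in>unit_disc. (\<lambda>n. f (r n) z) \<longlonglongrightarrow> g z"
      using bounded_holomorphic_subseq[of f "real N", OF f(1,2)] by blast
    have "g (lam j) = apply_bcontfun l j" if j: "j \<in> I" for j
    proof (rule LIMSEQ_unique)
      show "(\<lambda>n. f (r n) (lam j)) \<longlonglongrightarrow> g (lam j)" using g(4) lam[OF j] by blast
      have "(\<lambda>n. x (r n)) \<longlonglongrightarrow> l" using LIMSEQ_subseq_LIMSEQ[OF l g(3)] by (simp add: o_def)
      hence "(\<lambda>n. dist (x (r n)) l) \<longlonglongrightarrow> 0" by (simp add: tendsto_dist_iff[symmetric])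
      hence "(\<lambda>n. dist (apply_bcontfun (x (r n)) j) (apply_bcontfun l j)) \<longlonglongrightarrow> 0"
        by (rule tendsto_sandwich[OF _ _ tendsto_const, rotated 2]) (auto intro!: always_eventually dist_bounded)
      thus "(\<lambda>n. f (r n) (lam j)) \<longlonglongrightarrow> apply_bcontfun l j"
        using f(3)[OF j] by (simp add: tendsto_dist_iff[symmetric])
    qed
    thus "l \<in> E N" using g(1,2) unfolding E_def by blast
  qed
  have cover: "(\<Union>N. E N) = UNIV"
  proof -
    have "a \<in> (\<Union>N. E N)" for a
    proof -
      have "bounded (range (apply_bcontfun a))"
        using apply_bcontfun[of a] by (simp add: bcontfun_def)
      hence "bounded (apply_bcontfun a ` I)" by (rule bounded_subset) auto
      then obtain f where f: "f holomorphic_on unit_disc" "bounded (f ` unit_disc)"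
          "\<forall>j\<in>I. f (lam j) = apply_bcontfun a j"
        using assms unfolding carleson_seq_def H_infinity_def by blast
      from f(2) obtain B where B: "\<And>z. z \<in> unit_disc \<Longrightarrow> cmod (f z) \<le> B"
        unfolding bounded_iff by blast
      obtain N where "B \<le> real N" using real_arch_simple by blast
      with B have "\<forall>z\<in>unit_disc. cmod (f z) \<le> real N" by (meson order_trans)
      hence "a \<in> E N" using f unfolding E_def by blast
      thus ?thesis by blast
    qed
    thus ?thesis by blast
  qed
  have "\<exists>N. interior (E N) \<noteq> {}"
  proof (rule ccontr)
    assume "\<not> ?thesis"
    moreover have "Met_TC.mcomplete TYPE(nat \<Rightarrow>\<^sub>C complex)"
      using complete_bounded_sequences by simp
    ultimately have "Met_TC.mtopology interior_of \<Union>(range E) = {}"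
      by (intro Met_TC.metric_Baire_category_alt) (use closed in auto)
    thus False using cover by simp
  qed
  then obtain N a where "a \<in> interior (E N)" by blast
  then obtain \<epsilon> where \<epsilon>: "0 < \<epsilon>" "ball a \<epsilon> \<subseteq> E N" by (auto simp: mem_interior)
  show thesis
  proof (rule that[of "4 * real N / \<epsilon> + 1"])
    show "0 < 4 * real N / \<epsilon> + 1" using \<epsilon> by (simp add: add_nonneg_pos)
    fix j assume j: "j \<in> I"
    define e where "e = (\<lambda>k::nat. if k = j then 1 else 0 :: complex)"
    have "e \<in> bcontfun"
      by (rule bcontfun_normI[of _ 1]) (auto simp: e_def)
    hence app_e: "apply_bcontfun (Bcontfun e) = e" by (rule Bcontfun_inverse)
    have "norm (Bcontfun e) \<le> 1" by (rule norm_bound) (simp only: app_e, simp add: e_def)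
    define b where "b = a + (\<epsilon> / 2) *\<^sub>R Bcontfun e"
    have "dist a b \<le> \<epsilon> / 2"
      using \<open>norm (Bcontfun e) \<le> 1\<close> \<epsilon>(1) by (simp add: b_def dist_norm mult_left_le)
    hence "b \<in> E N" "a \<in> E N" using \<epsilon> by auto
    then obtain f g where f: "f holomorphic_on unit_disc" "\<forall>z\<in>unit_disc. cmod (f z) \<le> real N"
        "\<forall>k\<in>I. f (lam k) = apply_bcontfun b k"
      and g: "g holomorphic_on unit_disc" "\<forall>z\<in>unit_disc. cmod (g z) \<le> real N"
        "\<forall>k\<in>I. g (lam k) = apply_bcontfun a k" unfolding E_def by blast
    let ?h = "\<lambda>z. (f z - g z) * of_real (2 / \<epsilon>)"
    have "?h holomorphic_on unit_disc" using f(1) g(1) by (intro holomorphic_intros)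
    moreover have "cmod (?h z) \<le> 4 * real N / \<epsilon> + 1" if "z \<in> unit_disc" for z
    proof -
      have "cmod (f z - g z) \<le> 2 * real N"
        using f(2) g(2) that norm_triangle_ineq4[of "f z" "g z"] by fastforce
      hence "cmod (f z - g z) * (2 / \<epsilon>) \<le> 2 * real N * (2 / \<epsilon>)"
        using \<epsilon>(1) by (intro mult_right_mono) auto
      moreover have "cmod (?h z) = cmod (f z - g z) * (2 / \<epsilon>)"
        using \<epsilon>(1) by (simp only: norm_mult norm_of_real) simp
      ultimately show ?thesis by simp
    qed
    moreover have "?h (lam k) = (if k = j then 1 else 0)" if "k \<in> I" for k
      using f(3) g(3) that \<epsilon>(1) by (simp add: b_def plus_bcontfun.rep_eq scaleR_bcontfun.rep_eq app_e)
        (simp add: e_def scaleR_conv_of_real)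
    ultimately show "\<exists>f. f holomorphic_on unit_disc \<and> (\<forall>z\<in>unit_disc. cmod (f z) \<le> 4 * real N / \<epsilon> + 1) \<and>
        f (lam j) = 1 \<and> (\<forall>k\<in>I. k \<noteq> j \<longrightarrow> f (lam k) = 0)"
      using j by (intro exI[of _ ?h]) auto
  qed
qed

text \<open>The function that is 1 at \<open>\<lambda>\<^sub>j\<close> and vanishes at the other points bounds the product of
  the distances \<open>\<rho>(\<lambda>\<^sub>j, \<lambda>\<^sub>k)\<close> from below by \<open>1 / M\<close>. A single factor gives the separation;
  the inequality \<open>1 - x \<le> exp (- x)\<close> turns the product into the bound for the sum.\<close>
lemma carleson_seq_necessary:
  assumes "carleson_seq I lam"
  shows "pd_separated I lam" "corr_bounded I lam"
proof -
  have lam: "\<And>j. j \<in> I \<Longrightarrow> lam j \<in> unit_disc" using assms by (auto simp: carleson_seq_def)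
  obtain M where M: "0 < M"
    "\<And>j. j \<in> I \<Longrightarrow> \<exists>f. f holomorphic_on unit_disc \<and> (\<forall>z\<in>unit_disc. cmod (f z) \<le> M) \<and>
        f (lam j) = 1 \<and> (\<forall>k\<in>I. k \<noteq> j \<longrightarrow> f (lam k) = 0)"
    using carleson_seq_uniform_dual[OF assms] by blast
  have sep: "1 / M \<le> pdist (lam j) (lam k)" if jk: "j \<in> I" "k \<in> I" "j \<noteq> k" for j k
  proof -
    obtain f where f: "f holomorphic_on unit_disc" "\<And>z. z\<in>unit_disc \<Longrightarrow> cmod (f z) \<le> M"
        "f (lam j) = 1" "f (lam k) = 0"
      using M(2)[OF jk(1)] jk by metis
    show ?thesis using schwarz_pick_zero[OF f(1,2) lam[OF jk(2)] f(4) lam[OF jk(1)]] f(3) M(1)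
      by (simp add: field_simps)
  qed
  thus "pd_separated I lam" unfolding pd_separated_def using M(1)
    by (intro exI[of _ "1 / M"]) auto
  have inj: "inj_on lam I"
  proof (rule inj_onI, rule ccontr)
    fix j k assume "j \<in> I" "k \<in> I" "lam j = lam k" "j \<noteq> k"
    thus False using sep[of j k] M(1) by (simp add: pdist_def)
  qed
  have "(\<Sum>k\<in>F. szego_corr (lam j) (lam k)) \<le> ln (M\<^sup>2) + 1"
    if j: "j \<in> I" and F: "finite F" "F \<subseteq> I" for j F
  proof -
    let ?G = "F - {j}"
    obtain f where f: "f holomorphic_on unit_disc" "\<And>z. z\<in>unit_disc \<Longrightarrow> cmod (f z) \<le> M"
        "f (lam j) = 1" "\<And>k. k \<in> I \<Longrightarrow> k \<noteq> j \<Longrightarrow> f (lam k) = 0"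
      using M(2)[OF j] by metis
    have "cmod (f (lam j)) \<le> M * (\<Prod>w\<in>lam ` ?G. pdist (lam j) w)"
      by (rule schwarz_pick_zeros) (use F f lam j in auto)
    also have "(\<Prod>w\<in>lam ` ?G. pdist (lam j) w) = (\<Prod>k\<in>?G. pdist (lam j) (lam k))"
      using inj F by (subst prod.reindex) (auto intro: inj_on_subset)
    finally have "1 \<le> M * (\<Prod>k\<in>?G. pdist (lam j) (lam k))" using f(3) by simp
    hence "1 \<le> (M * (\<Prod>k\<in>?G. pdist (lam j) (lam k)))\<^sup>2" by simp
    also have "\<dots> = M\<^sup>2 * (\<Prod>k\<in>?G. (pdist (lam j) (lam k))\<^sup>2)"
      by (simp add: power_mult_distrib prod_power_distrib)
    also have "\<dots> \<le> M\<^sup>2 * (\<Prod>k\<in>?G. exp (- szego_corr (lam j) (lam k)))"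
    proof (intro mult_left_mono prod_mono conjI)
      fix k assume "k \<in> ?G"
      hence "szego_corr (lam j) (lam k) = 1 - (pdist (lam j) (lam k))\<^sup>2"
        using F lam j by (intro szego_corr_eq) auto
      thus "(pdist (lam j) (lam k))\<^sup>2 \<le> exp (- szego_corr (lam j) (lam k))"
        using exp_ge_add_one_self[of "- szego_corr (lam j) (lam k)"] by simp
    qed auto
    also have "\<dots> = M\<^sup>2 * exp (- (\<Sum>k\<in>?G. szego_corr (lam j) (lam k)))"
      using F by (simp add: exp_sum sum_negf[symmetric])
    finally have "exp (\<Sum>k\<in>?G. szego_corr (lam j) (lam k)) \<le> M\<^sup>2"
      by (simp add: exp_minus field_simps)
    hence "(\<Sum>k\<in>?G. szego_corr (lam j) (lam k)) \<le> ln (M\<^sup>2)"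
      using M(1) by (simp add: ln_ge_iff)
    moreover have "(\<Sum>k\<in>F. szego_corr (lam j) (lam k)) \<le> (\<Sum>k\<in>?G. szego_corr (lam j) (lam k)) + 1"
    proof (cases "j \<in> F")
      case True
      have "szego_corr (lam j) (lam j) = 1"
        using szego_corr_eq[OF lam[OF j] lam[OF j]] by (simp add: pdist_def)
      thus ?thesis using sum.remove[OF F(1) True, of "\<lambda>k. szego_corr (lam j) (lam k)"] by simp
    qed simp
    ultimately show ?thesis by simp
  qed
  thus "corr_bounded I lam" unfolding corr_bounded_def by blast
qed

section \<open>Sufficiency in Carleson's interpolation theorem\<close>

text \<open>A discrete form of \<open>\<integral> exp (- t) dt \<le> 1\<close>: when the indices are listed by decreasing
  \<open>r\<close>, the sum is dominated by a telescoping sum, since \<open>x exp (- x) \<le> 1 - exp (- x)\<close>. Ties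
  in \<open>r\<close> only make the exponents smaller.\<close>
lemma sum_mult_exp_tail_le:
  fixes x r :: "'a \<Rightarrow> real"
  assumes "finite F" "\<And>j. j \<in> F \<Longrightarrow> 0 \<le> x j"
  shows "(\<Sum>j\<in>F. x j * exp (- (\<Sum>k\<in>{k \<in> F. r j \<le> r k}. x k))) \<le> 1 - exp (- (\<Sum>k\<in>F. x k))"
  using assms
proof (induction F rule: finite_ranking_induct[where f = "\<lambda>k. - r k"])
  case empty
  show ?case by simp
next
  case (insert m S)
  show ?case
  proof (cases "m \<in> S")
    case True
    thus ?thesis using insert by (simp add: insert_absorb)
  next
    case False
    have "{k \<in> insert m S. r m \<le> r k} = insert m S" using insert.hyps by auto
    hence "x m * exp (- (\<Sum>k\<in>{k \<in> insert m S. r m \<le> r k}. x k))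
        = x m * exp (- x m) * exp (- (\<Sum>k\<in>S. x k))"
      using False insert.hyps by (simp add: mult_exp_exp)
    also have "\<dots> \<le> (1 - exp (- x m)) * exp (- (\<Sum>k\<in>S. x k))"
    proof (rule mult_right_mono)
      have "(1 + x m) * exp (- x m) \<le> exp (x m) * exp (- x m)"
        by (intro mult_right_mono exp_ge_add_one_self) simp
      thus "x m * exp (- x m) \<le> 1 - exp (- x m)" by (simp add: exp_minus algebra_simps)
    qed simp
    also have "\<dots> = exp (- (\<Sum>k\<in>S. x k)) - exp (- (\<Sum>k\<in>insert m S. x k))"
      using False insert.hyps by (simp add: algebra_simps mult_exp_exp)
    finally have m: "x m * exp (- (\<Sum>k\<in>{k \<in> insert m S. r m \<le> r k}. x k))
        \<le> exp (- (\<Sum>k\<in>S. x k)) - exp (- (\<Sum>k\<in>insert m S. x k))" .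
    have "(\<Sum>j\<in>S. x j * exp (- (\<Sum>k\<in>{k \<in> insert m S. r j \<le> r k}. x k)))
        \<le> (\<Sum>j\<in>S. x j * exp (- (\<Sum>k\<in>{k \<in> S. r j \<le> r k}. x k)))"
      using insert.prems insert.hyps
      by (intro sum_mono mult_left_mono) (auto intro!: sum_mono2)
    also have "\<dots> \<le> 1 - exp (- (\<Sum>k\<in>S. x k))" using insert by auto
    finally show ?thesis using m False insert.hyps by simp
  qed
qed

text \<open>Converts the bound for the sums of \<open>1 - \<rho>\<^sup>2\<close> back into a lower bound for products of
  \<open>\<rho>\<close>; this is where separation enters, since \<open>ln y \<ge> 1 - 1 / y\<close> is useful only for \<open>y\<close>
  away from zero.\<close>
lemma exp_corr_le_pdist:
  assumes "z \<in> unit_disc" "w \<in> unit_disc" "0 < \<delta>" "\<delta> \<le> pdist z w"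
  shows "exp (- szego_corr z w / \<delta>\<^sup>2) \<le> pdist z w"
proof -
  define y where "y = (pdist z w)\<^sup>2"
  have corr: "szego_corr z w = 1 - y" using szego_corr_eq assms by (simp add: y_def)
  have y: "0 < y" "\<delta>\<^sup>2 \<le> y" using assms by (auto simp: y_def)
  have "1 + (1 - y) / y \<le> exp ((1 - y) / y)" by simp
  hence "1 / y \<le> exp ((1 - y) / y)" using y by (simp add: field_simps)
  also have "\<dots> \<le> exp ((1 - y) / \<delta>\<^sup>2)"
  proof -
    have "0 \<le> 1 - y" using szego_corr_pos[OF assms(1,2)] corr by simp
    thus ?thesis using y assms(3) by (simp add: frac_le)
  qed
  finally have "exp (- ((1 - y) / \<delta>\<^sup>2)) \<le> y"
    using y by (simp add: exp_minus field_simps)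
  also have "y \<le> pdist z w"
    using pdist_le_1[OF assms(1,2)] by (simp add: y_def power2_eq_square mult_left_le)
  finally show ?thesis by (simp only: corr minus_divide_left)
qed

lemma Re_cayley: "Re ((1 + c) / (1 - c)) = (1 - (cmod c)\<^sup>2) / (cmod (1 - c))\<^sup>2"
proof -
  have "Re ((1 + c) * cnj (1 - c)) = 1 - (cmod c)\<^sup>2"
    unfolding cmod_power2 by (simp add: power2_eq_square algebra_simps)
  thus ?thesis
    unfolding complex_div_cnj[of "1 + c"] of_real_power[symmetric] Re_divide_of_real by simp
qed

text \<open>The real part is the Poisson-type quantity that makes the exponential factors in the
  interpolation formula decay.\<close>
definition herglotz_weight :: "complex \<Rightarrow> complex \<Rightarrow> complex" where
  "herglotz_weight w z = of_real (1 - (cmod w)\<^sup>2) * ((1 + cnj w * z) / (1 - cnj w * z))"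

lemma Re_herglotz_weight:
  assumes "w \<in> unit_disc" "z \<in> unit_disc"
  shows "Re (herglotz_weight w z) =
    (1 - (cmod w)\<^sup>2) * (1 - (cmod w)\<^sup>2 * (cmod z)\<^sup>2) / (cmod (1 - cnj w * z))\<^sup>2"
proof -
  have re: "Re (of_real p * c) = p * Re c" for p c by simp
  show ?thesis unfolding herglotz_weight_def re Re_cayley
    by (simp add: norm_mult power_mult_distrib)
qed

lemma Re_herglotz_weight_ge:
  assumes "w \<in> unit_disc" "z \<in> unit_disc"
  shows "((1 - (cmod w)\<^sup>2) / cmod (1 - cnj w * z))\<^sup>2 \<le> Re (herglotz_weight w z)"
proof -
  have "(cmod z)\<^sup>2 \<le> 1" using one_minus_cmod_sq_pos[OF assms(2)] by simp
  hence "(1 - (cmod w)\<^sup>2) * (1 - (cmod w)\<^sup>2)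
      \<le> (1 - (cmod w)\<^sup>2) * (1 - (cmod w)\<^sup>2 * (cmod z)\<^sup>2)"
    using one_minus_cmod_sq_pos[OF assms(1)] by (intro mult_left_mono) (auto simp: mult_left_le)
  thus ?thesis using Re_herglotz_weight[OF assms]
    by (simp add: power_divide power2_eq_square[of "1 - (cmod w)\<^sup>2"] divide_right_mono)
qed

text \<open>The restriction \<open>|z| \<le> |w|\<close> is the reason why the interpolation formula sums only over
  the points that are at least as close to the circle as the current one.\<close>
lemma Re_herglotz_weight_le:
  assumes "w \<in> unit_disc" "z \<in> unit_disc" "cmod z \<le> cmod w"
  shows "Re (herglotz_weight w z) \<le> 2 * szego_corr z w"
proof -
  define p q where "p = (cmod w)\<^sup>2" and "q = (cmod z)\<^sup>2"
  have pq: "q \<le> p" "0 \<le> q" "p < 1"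
    using assms one_minus_cmod_sq_pos[OF assms(1)] by (auto simp: p_def q_def power_mono)
  have "q * q \<le> p * q" using pq by (intro mult_right_mono) auto
  hence "1 - p * q \<le> 2 * (1 - q)" using sum_squares_bound[of 1 q] by (simp add: power2_eq_square)
  hence "(1 - p) * (1 - p * q) \<le> (1 - p) * (2 * (1 - q))" using pq by (intro mult_left_mono) auto
  also have "\<dots> = 2 * ((1 - q) * (1 - p))" by simp
  finally show ?thesis
    unfolding Re_herglotz_weight[OF assms(1,2)] szego_corr_def cmod_one_minus_cnj_commute[of z w]
      p_def[symmetric] q_def[symmetric]
    by (metis divide_right_mono times_divide_eq_right zero_le_power2)
qed

text \<open>P. Jones's formula. The interpolating function is the sum over \<open>j\<close> of \<open>a\<^sub>j\<close> times a
  normalised Blaschke product vanishing at the other points, times the square of a normalised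
  Szego kernel, times an exponential factor. The squared kernel has modulus \<open>x\<^sub>j\<close>, and the
  exponential is at most a constant times \<open>exp (- \<Sum> x\<^sub>k)\<close>, the sum being over the points with
  \<open>|\<lambda>\<^sub>k| \<ge> |\<lambda>\<^sub>j|\<close>. Thus \<open>sum_mult_exp_tail_le\<close> bounds the whole sum independently of the
  number of points.\<close>
lemma jones_interpolation:
  fixes lam :: "'a \<Rightarrow> complex"
  assumes F: "finite F" and lam: "\<And>j. j \<in> F \<Longrightarrow> lam j \<in> unit_disc"
    and \<delta>: "0 < \<delta>" "\<And>j k. j \<in> F \<Longrightarrow> k \<in> F \<Longrightarrow> j \<noteq> k \<Longrightarrow> \<delta> \<le> pdist (lam j) (lam k)"
    and M: "\<And>j. j \<in> F \<Longrightarrow> (\<Sum>k\<in>F. szego_corr (lam j) (lam k)) \<le> M"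
    and A: "0 \<le> A" "\<And>j. j \<in> F \<Longrightarrow> cmod (a j) \<le> A"
  shows "\<exists>f. f holomorphic_on unit_disc \<and>
     (\<forall>z\<in>unit_disc. cmod (f z) \<le> A * exp (M / \<delta>\<^sup>2) * exp (2 * M)) \<and> (\<forall>j\<in>F. f (lam j) = a j)"
proof -
  \<comment> \<open>Subtracting \<open>g j z\<close> from \<open>g j (lam j)\<close> and dividing by \<open>b j (lam j)\<close> makes each factor
    equal to 1 at \<open>lam j\<close>; the kernel \<open>s j\<close> is already normalised in this way.\<close>
  define b where "b = (\<lambda>j z. \<Prod>k\<in>F - {j}. (z - lam k) / (1 - cnj (lam k) * z))"
  define T where "T = (\<lambda>j. {k \<in> F. cmod (lam j) \<le> cmod (lam k)})"
  define g where "g = (\<lambda>j z. \<Sum>k\<in>T j. herglotz_weight (lam k) z)"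
  define s where "s = (\<lambda>j z. of_real (1 - (cmod (lam j))\<^sup>2) / (1 - cnj (lam j) * z))"
  define f where "f = (\<lambda>z. \<Sum>j\<in>F. a j * (b j z / b j (lam j)) * (s j z)\<^sup>2 * exp (g j (lam j) - g j z))"
  have nz: "1 - cnj (lam k) * z \<noteq> 0" if "k \<in> F" "z \<in> unit_disc" for k z
    using one_minus_cnj_mult_nonzero[of "lam k" z] lam that by simp
  have T: "T j \<subseteq> F" "finite (T j)" for j using F by (auto simp: T_def)
  have b_norm: "cmod (b j z) = (\<Prod>k\<in>F - {j}. pdist z (lam k))" for j z
    unfolding b_def prod_norm[symmetric]
  proof (rule prod.cong)
    fix k show "cmod ((z - lam k) / (1 - cnj (lam k) * z)) = pdist z (lam k)"
      by (subst pdist_commute) (simp add: pdist_def norm_divide norm_minus_commute)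
  qed simp
  have b_le: "cmod (b j z) \<le> 1" if "z \<in> unit_disc" for j z
    unfolding b_norm by (rule prod_le_1) (use pdist_le_1 lam that in auto)
  have b_ge: "exp (- (M / \<delta>\<^sup>2)) \<le> cmod (b j (lam j))" if j: "j \<in> F" for j
  proof -
    have "(\<Sum>k\<in>F - {j}. szego_corr (lam j) (lam k)) \<le> (\<Sum>k\<in>F. szego_corr (lam j) (lam k))"
      by (rule sum_mono2) (use F szego_corr_pos lam j in \<open>auto intro: less_imp_le\<close>)
    hence "- (M / \<delta>\<^sup>2) \<le> - (\<Sum>k\<in>F - {j}. szego_corr (lam j) (lam k)) / \<delta>\<^sup>2"
      using M[OF j] \<delta> by (simp add: divide_right_mono)
    also have "\<dots> = (\<Sum>k\<in>F - {j}. - szego_corr (lam j) (lam k) / \<delta>\<^sup>2)"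
      by (simp add: sum_divide_distrib sum_negf)
    finally have "exp (- (M / \<delta>\<^sup>2)) \<le> (\<Prod>k\<in>F - {j}. exp (- szego_corr (lam j) (lam k) / \<delta>\<^sup>2))"
      using F by (simp add: exp_sum[symmetric])
    also have "\<dots> \<le> cmod (b j (lam j))"
      unfolding b_norm using \<delta> lam j by (intro prod_mono conjI exp_corr_le_pdist) auto
    finally show ?thesis .
  qed
  have b_nz: "b j (lam j) \<noteq> 0" if "j \<in> F" for j
    using b_ge[OF that] exp_gt_zero[of "- (M / \<delta>\<^sup>2)"] by (metis norm_zero not_le)
  have hol: "f holomorphic_on unit_disc"
    unfolding f_def b_def g_def s_def herglotz_weight_def
    using nz T b_nz by (intro holomorphic_intros) (auto simp: b_def)
  have bound: "cmod (f z) \<le> A * exp (M / \<delta>\<^sup>2) * exp (2 * M)" if z: "z \<in> unit_disc" for z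
  proof -
    define x where "x = (\<lambda>k. ((1 - (cmod (lam k))\<^sup>2) / cmod (1 - cnj (lam k) * z))\<^sup>2)"
    define C where "C = A * exp (M / \<delta>\<^sup>2) * exp (2 * M)"
    have C0: "0 \<le> C" using A by (simp add: C_def)
    have "cmod (f z) \<le> (\<Sum>j\<in>F. C * (x j * exp (- (\<Sum>k\<in>T j. x k))))"
      unfolding f_def
    proof (rule sum_norm_le)
      fix j assume j: "j \<in> F"
      have s: "cmod ((s j z)\<^sup>2) = x j"
        by (simp only: s_def x_def norm_power norm_divide norm_of_real power_divide power2_abs)
      have 1: "cmod (b j z / b j (lam j)) \<le> exp (M / \<delta>\<^sup>2)"
      proof -
        have "cmod (b j z) / cmod (b j (lam j)) \<le> 1 / exp (- (M / \<delta>\<^sup>2))"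
          using b_le[OF z, of j] b_ge[OF j] by (intro frac_le) auto
        thus ?thesis by (simp add: norm_divide exp_minus field_simps)
      qed
      have "Re (g j (lam j)) \<le> 2 * M"
      proof -
        have "Re (g j (lam j)) = (\<Sum>k\<in>T j. Re (herglotz_weight (lam k) (lam j)))"
          by (simp add: g_def)
        also have "\<dots> \<le> (\<Sum>k\<in>T j. 2 * szego_corr (lam j) (lam k))"
          by (rule sum_mono) (use j lam in \<open>auto simp: T_def intro!: Re_herglotz_weight_le\<close>)
        also have "\<dots> \<le> (\<Sum>k\<in>F. 2 * szego_corr (lam j) (lam k))"
          by (rule sum_mono2) (use F T szego_corr_pos lam j in \<open>auto intro: less_imp_le\<close>)
        also have "\<dots> \<le> 2 * M" using M[OF j] by (simp add: sum_distrib_left[symmetric])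
        finally show ?thesis .
      qed
      moreover have "(\<Sum>k\<in>T j. x k) \<le> Re (g j z)"
        unfolding g_def Re_sum x_def
        by (rule sum_mono) (use lam z in \<open>auto simp: T_def intro!: Re_herglotz_weight_ge\<close>)
      ultimately have 2: "cmod (exp (g j (lam j) - g j z)) \<le> exp (2 * M) * exp (- (\<Sum>k\<in>T j. x k))"
        by (simp add: norm_exp_eq_Re mult_exp_exp)
      have "cmod (a j * (b j z / b j (lam j)) * (s j z)\<^sup>2 * exp (g j (lam j) - g j z))
          = cmod (a j) * cmod (b j z / b j (lam j)) * x j * cmod (exp (g j (lam j) - g j z))"
        by (simp only: norm_mult s)
      also have "\<dots> \<le> A * exp (M / \<delta>\<^sup>2) * x j * (exp (2 * M) * exp (- (\<Sum>k\<in>T j. x k)))"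
        by (intro mult_mono 1 2 A j mult_nonneg_nonneg) (auto simp: x_def A)
      finally show "cmod (a j * (b j z / b j (lam j)) * (s j z)\<^sup>2 * exp (g j (lam j) - g j z))
          \<le> C * (x j * exp (- (\<Sum>k\<in>T j. x k)))" by (simp add: C_def mult_ac)
    qed
    also have "\<dots> = C * (\<Sum>j\<in>F. x j * exp (- (\<Sum>k\<in>T j. x k)))"
      by (simp add: sum_distrib_left)
    also have "\<dots> \<le> C * 1"
    proof (rule mult_left_mono[OF _ C0])
      have "(\<Sum>j\<in>F. x j * exp (- (\<Sum>k\<in>T j. x k))) \<le> 1 - exp (- (\<Sum>k\<in>F. x k))"
        unfolding T_def by (rule sum_mult_exp_tail_le[OF F]) (simp add: x_def)
      thus "(\<Sum>j\<in>F. x j * exp (- (\<Sum>k\<in>T j. x k))) \<le> 1"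
        using exp_gt_zero[of "- (\<Sum>k\<in>F. x k)"] by linarith
    qed
    finally show ?thesis by (simp add: C_def)
  qed
  have interp: "f (lam i) = a i" if i: "i \<in> F" for i
  proof -
    have "f (lam i) = (\<Sum>j\<in>F. if j = i then a i else 0)"
      unfolding f_def
    proof (rule sum.cong)
      fix j assume j: "j \<in> F"
      show "a j * (b j (lam i) / b j (lam j)) * (s j (lam i))\<^sup>2 * exp (g j (lam j) - g j (lam i))
          = (if j = i then a i else 0)"
      proof (cases "j = i")
        case True
        have "s i (lam i) = 1"
          using nz[OF i lam[OF i]] complex_norm_square[of "lam i"] by (simp add: s_def mult.commute)
        thus ?thesis using True b_nz[OF i] by simp
      next
        case False
        hence "b j (lam i) = 0" unfolding b_def using F i by (intro prod_zero) auto
        thus ?thesis using False by simp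
      qed
    qed simp
    also have "\<dots> = a i" using F i by simp
    finally show ?thesis .
  qed
  show ?thesis using hol bound interp by blast
qed

text \<open>Finite subfamilies are interpolated with a uniform bound, and a normal family argument
  gives the function for the whole family.\<close>
lemma carleson_seq_sufficient:
  assumes lam: "lam ` I \<subseteq> unit_disc" and sep: "pd_separated I lam" and corr: "corr_bounded I lam"
  shows "carleson_seq I lam"
  unfolding carleson_seq_def
proof (intro conjI lam allI impI)
  fix a :: "nat \<Rightarrow> complex" assume "bounded (a ` I)"
  then obtain A where A: "0 < A" "\<And>j. j \<in> I \<Longrightarrow> cmod (a j) \<le> A"
    unfolding bounded_pos by auto
  obtain \<delta> where \<delta>: "0 < \<delta>"
      "\<And>j k. j \<in> I \<Longrightarrow> k \<in> I \<Longrightarrow> j \<noteq> k \<Longrightarrow> \<delta> \<le> pdist (lam j) (lam k)"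
    using sep unfolding pd_separated_def by blast
  obtain M where M: "\<And>j F. j \<in> I \<Longrightarrow> finite F \<Longrightarrow> F \<subseteq> I \<Longrightarrow>
      (\<Sum>k\<in>F. szego_corr (lam j) (lam k)) \<le> M"
    using corr unfolding corr_bounded_def by blast
  define C where "C = A * exp (M / \<delta>\<^sup>2) * exp (2 * M)"
  have "\<exists>f. f holomorphic_on unit_disc \<and> (\<forall>z\<in>unit_disc. cmod (f z) \<le> C) \<and>
      (\<forall>j\<in>I \<inter> {..<n}. f (lam j) = a j)" for n
    unfolding C_def by (rule jones_interpolation) (use lam A \<delta> M in auto)
  hence "\<forall>n. \<exists>f. f holomorphic_on unit_disc \<and> (\<forall>z\<in>unit_disc. cmod (f z) \<le> C) \<and>
      (\<forall>j\<in>I \<inter> {..<n}. f (lam j) = a j)" by blast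
  from choice[OF this] obtain f where f: "\<And>n. f n holomorphic_on unit_disc"
      "\<And>n z. z \<in> unit_disc \<Longrightarrow> cmod (f n z) \<le> C"
      "\<And>n j. j \<in> I \<Longrightarrow> j < n \<Longrightarrow> f n (lam j) = a j"
    by blast
  obtain g r where g: "g holomorphic_on unit_disc" "\<forall>z\<in>unit_disc. cmod (g z) \<le> C"
      "strict_mono (r :: nat \<Rightarrow> nat)" "\<forall>z\<in>unit_disc. (\<lambda>n. f (r n) z) \<longlonglongrightarrow> g z"
    using bounded_holomorphic_subseq[of f C, OF f(1,2)] by blast
  have "g (lam j) = a j" if j: "j \<in> I" for j
  proof (rule LIMSEQ_unique)
    show "(\<lambda>n. f (r n) (lam j)) \<longlonglongrightarrow> g (lam j)" using g(4) lam j by blast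
    have "\<forall>\<^sub>F n in sequentially. f (r n) (lam j) = a j"
      using eventually_gt_at_top[of j]
      by (rule eventually_mono) (use f(3)[OF j] seq_suble[OF g(3)] in \<open>auto intro: less_le_trans\<close>)
    thus "(\<lambda>n. f (r n) (lam j)) \<longlonglongrightarrow> a j" by (rule tendsto_eventually)
  qed
  moreover have "g \<in> H_infinity" using g(1,2) by (auto simp: H_infinity_def bounded_iff)
  ultimately show "\<exists>f\<in>H_infinity. \<forall>j\<in>I. f (lam j) = a j" by blast
qed

text \<open>Carleson's theorem, with the lower bound for the infinite product of distances expressed
  by separation and a bounded sum. The sum is easier to compare along a map than the product.\<close>
theorem carleson_interpolation:
  assumes "lam ` I \<subseteq> unit_disc"
  shows "carleson_seq I lam \<longleftrightarrow> pd_separated I lam \<and> corr_bounded I lam"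
  using carleson_seq_necessary carleson_seq_sufficient[OF assms] by blast

section \<open>Stability of interpolating sequences under bounded displacement\<close>

lemma one_minus_cmod_sq_diff_le:
  assumes "cmod z \<le> 1" "cmod u \<le> 1"
  shows "1 - (cmod u)\<^sup>2 \<le> 1 - (cmod z)\<^sup>2 + 2 * cmod (z - u)"
proof -
  have "(cmod z)\<^sup>2 - (cmod u)\<^sup>2 = (cmod z - cmod u) * (cmod z + cmod u)"
    by (simp add: power2_eq_square algebra_simps)
  also have "\<dots> \<le> cmod (z - u) * 2"
    using assms norm_triangle_ineq2[of z u] by (intro mult_mono) auto
  finally show ?thesis by simp
qed

lemma cmod_one_minus_cnj_ge:
  assumes "z \<in> unit_disc" "w \<in> unit_disc"
  shows "1 - (cmod z)\<^sup>2 \<le> 2 * cmod (1 - cnj z * w)" "cmod (z - w) \<le> cmod (1 - cnj z * w)"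
proof -
  have "cmod (cnj z * w) \<le> cmod z" using assms by (simp add: norm_mult mult_left_le)
  hence "1 - cmod z \<le> cmod (1 - cnj z * w)" using norm_triangle_ineq2[of 1 "cnj z * w"] by simp
  thus "1 - (cmod z)\<^sup>2 \<le> 2 * cmod (1 - cnj z * w)" using one_minus_cmod_sq_le[of z] assms by simp
  have "(cmod (z - w))\<^sup>2 \<le> (cmod (1 - cnj z * w))\<^sup>2"
    unfolding cmod_one_minus_cnj_mult
    using mult_pos_pos[OF one_minus_cmod_sq_pos[OF assms(1)] one_minus_cmod_sq_pos[OF assms(2)]] by simp
  thus "cmod (z - w) \<le> cmod (1 - cnj z * w)" by (rule power2_le_imp_le) simp
qed

lemma cmod_one_minus_cnj_le:
  assumes "cmod z \<le> 1"
  shows "cmod (1 - cnj z * w) \<le> 1 - (cmod z)\<^sup>2 + cmod (z - w)"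
proof -
  have "1 - cnj z * w = of_real (1 - (cmod z)\<^sup>2) + cnj z * (z - w)"
    using complex_norm_square[of z] by (simp add: algebra_simps)
  also have "cmod \<dots> \<le> \<bar>1 - (cmod z)\<^sup>2\<bar> + cmod z * cmod (z - w)"
    by (metis complex_mod_cnj norm_mult norm_of_real norm_triangle_ineq)
  also have "\<dots> \<le> 1 - (cmod z)\<^sup>2 + cmod (z - w)"
  proof -
    have "(cmod z)\<^sup>2 \<le> 1" using assms by (simp add: power_le_one)
    moreover have "cmod z * cmod (z - w) \<le> cmod (z - w)" using assms by (simp add: mult_left_le_one_le)
    ultimately show ?thesis by simp
  qed
  finally show ?thesis .
qed

lemma pdist_mult_le:
  assumes "z \<in> unit_disc" "w \<in> unit_disc"
  shows "pdist z w * (1 - (cmod z)\<^sup>2) \<le> 2 * cmod (z - w)"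
proof -
  have "pdist z w * (1 - (cmod z)\<^sup>2) \<le> pdist z w * (2 * cmod (1 - cnj z * w))"
    by (intro mult_left_mono cmod_one_minus_cnj_ge assms) simp
  also have "\<dots> = 2 * cmod (z - w)"
    using one_minus_cnj_mult_nonzero[of z w] assms by (simp add: pdist_def norm_divide)
  finally show ?thesis .
qed

lemma cmod_diff_le_pdist:
  assumes "z \<in> unit_disc" "w \<in> unit_disc" "pdist z w \<le> 1 / 2"
  shows "cmod (z - w) \<le> 2 * pdist z w * (1 - (cmod z)\<^sup>2)"
proof -
  have "cmod (z - w) = pdist z w * cmod (1 - cnj z * w)"
    using one_minus_cnj_mult_nonzero[of z w] assms by (simp add: pdist_def norm_divide)
  also have "\<dots> \<le> pdist z w * (1 - (cmod z)\<^sup>2 + cmod (z - w))"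
    using assms by (intro mult_left_mono cmod_one_minus_cnj_le) auto
  also have "\<dots> \<le> pdist z w * (1 - (cmod z)\<^sup>2) + 1 / 2 * cmod (z - w)"
    using assms mult_right_mono[of "pdist z w" "1 / 2" "cmod (z - w)"] by (simp add: algebra_simps)
  finally show ?thesis by simp
qed

text \<open>The points lie within a bounded hyperbolic distance of each other. Both bounds are
  required so that the relation is symmetric with the same constant.\<close>
definition disc_close :: "real \<Rightarrow> complex \<Rightarrow> complex \<Rightarrow> bool" where
  "disc_close K z u \<longleftrightarrow>
     cmod (z - u) \<le> K * (1 - (cmod z)\<^sup>2) \<and> cmod (z - u) \<le> K * (1 - (cmod u)\<^sup>2)"

lemma disc_close_commute: "disc_close K z u \<longleftrightarrow> disc_close K u z"
  by (auto simp: disc_close_def norm_minus_commute)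

text \<open>All three quantities in the formula for \<open>szego_corr\<close> change by bounded factors. For the
  denominator this holds because \<open>|1 - cnj z w|\<close> is comparable to
  \<open>(1 - |z|\<^sup>2) + (1 - |w|\<^sup>2) + |z - w|\<close>.\<close>
lemma szego_corr_disc_close:
  assumes D: "z \<in> unit_disc" "w \<in> unit_disc" "u \<in> unit_disc" "y \<in> unit_disc"
    and K: "0 \<le> K" "disc_close K z u" "disc_close K w y"
  shows "szego_corr u y \<le> ((1 + 2 * K) * (3 + 8 * K))\<^sup>2 * szego_corr z w"
proof -
  define P Q where "P = (1 - (cmod z)\<^sup>2) * (1 - (cmod w)\<^sup>2)" and "Q = (1 - (cmod u)\<^sup>2) * (1 - (cmod y)\<^sup>2)"
  define m n where "m = cmod (1 - cnj z * w)" and "n = cmod (1 - cnj u * y)"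
  have pos: "0 < m" "0 < n" "0 < P"
    using one_minus_cnj_mult_nonzero D one_minus_cmod_sq_pos by (auto simp: m_def n_def P_def)
  have u: "1 - (cmod u)\<^sup>2 \<le> (1 + 2 * K) * (1 - (cmod z)\<^sup>2)"
    using one_minus_cmod_sq_diff_le[of z u] D K by (simp add: disc_close_def algebra_simps)
  have y: "1 - (cmod y)\<^sup>2 \<le> (1 + 2 * K) * (1 - (cmod w)\<^sup>2)"
    using one_minus_cmod_sq_diff_le[of w y] D K by (simp add: disc_close_def algebra_simps)
  have "Q \<le> ((1 + 2 * K) * (1 - (cmod z)\<^sup>2)) * ((1 + 2 * K) * (1 - (cmod w)\<^sup>2))"
    unfolding Q_def using u y K one_minus_cmod_sq_pos D
    by (intro mult_mono) (auto intro!: mult_nonneg_nonneg less_imp_le simp del: mem_ball_0)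
  hence Q: "Q \<le> (1 + 2 * K)\<^sup>2 * P" by (simp add: P_def power2_eq_square mult_ac)
  have "m \<le> (3 + 8 * K) * n"
  proof -
    have "m \<le> 1 - (cmod z)\<^sup>2 + cmod (z - w)"
      unfolding m_def using D by (intro cmod_one_minus_cnj_le) simp
    also have "1 - (cmod z)\<^sup>2 \<le> 1 - (cmod u)\<^sup>2 + 2 * cmod (z - u)"
      using one_minus_cmod_sq_diff_le[of u z] D by (simp add: norm_minus_commute)
    also have "cmod (z - w) \<le> cmod (z - u) + cmod (u - y) + cmod (w - y)"
      using norm_triangle_ineq[of "z - u" "u - w"] norm_triangle_ineq4[of "u - y" "w - y"] by simp
    also have "1 - (cmod u)\<^sup>2 + 2 * cmod (z - u) + (cmod (z - u) + cmod (u - y) + cmod (w - y))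
        \<le> (1 - (cmod u)\<^sup>2) + 3 * (K * (1 - (cmod u)\<^sup>2)) + cmod (u - y) + K * (1 - (cmod y)\<^sup>2)"
      using K by (simp add: disc_close_def)
    also have "\<dots> \<le> 2 * n + 3 * (K * (2 * n)) + n + K * (2 * n)"
    proof (intro add_mono mult_left_mono)
      show "1 - (cmod u)\<^sup>2 \<le> 2 * n" "1 - (cmod u)\<^sup>2 \<le> 2 * n" "cmod (u - y) \<le> n"
        unfolding n_def using cmod_one_minus_cnj_ge D by blast+
      show "1 - (cmod y)\<^sup>2 \<le> 2 * n"
        unfolding n_def cmod_one_minus_cnj_commute[of u y] using cmod_one_minus_cnj_ge D by blast
    qed (use K in auto)
    finally show ?thesis by (simp add: algebra_simps)
  qed
  hence "m\<^sup>2 \<le> ((3 + 8 * K) * n)\<^sup>2" using pos by (intro power_mono) auto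
  hence mn: "m\<^sup>2 \<le> (3 + 8 * K)\<^sup>2 * n\<^sup>2" by (simp add: power_mult_distrib)
  have "Q * m\<^sup>2 \<le> (1 + 2 * K)\<^sup>2 * P * ((3 + 8 * K)\<^sup>2 * n\<^sup>2)"
    using Q mn pos by (intro mult_mono) auto
  hence "Q / n\<^sup>2 \<le> ((1 + 2 * K) * (3 + 8 * K))\<^sup>2 * (P / m\<^sup>2)"
    unfolding power_mult_distrib[of "1 + 2 * K"] using pos by (simp add: divide_simps mult_ac)
  thus ?thesis by (simp add: szego_corr_def P_def Q_def m_def n_def)
qed

lemma corr_bounded_disc_close:
  assumes "0 \<le> K" "\<And>j. j \<in> I \<Longrightarrow> lam j \<in> unit_disc \<and> mu j \<in> unit_disc \<and> disc_close K (lam j) (mu j)"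
    and "corr_bounded I lam"
  shows "corr_bounded I mu"
proof -
  define L where "L = ((1 + 2 * K) * (3 + 8 * K))\<^sup>2"
  obtain M where M: "\<And>j F. j \<in> I \<Longrightarrow> finite F \<Longrightarrow> F \<subseteq> I \<Longrightarrow>
      (\<Sum>k\<in>F. szego_corr (lam j) (lam k)) \<le> M"
    using assms(3) unfolding corr_bounded_def by blast
  have "(\<Sum>k\<in>F. szego_corr (mu j) (mu k)) \<le> L * M" if "j \<in> I" "finite F" "F \<subseteq> I" for j F
  proof -
    have "(\<Sum>k\<in>F. szego_corr (mu j) (mu k)) \<le> (\<Sum>k\<in>F. L * szego_corr (lam j) (lam k))"
      unfolding L_def by (intro sum_mono szego_corr_disc_close) (use assms that in auto)
    also have "\<dots> \<le> L * M" unfolding sum_distrib_left[symmetric]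
      using M[OF that] by (intro mult_left_mono) (auto simp: L_def)
    finally show ?thesis .
  qed
  thus ?thesis unfolding corr_bounded_def by blast
qed

lemma pd_separated_image:
  assumes "\<And>\<epsilon>. 0 < \<epsilon> \<Longrightarrow> \<exists>\<delta>>0. \<forall>j\<in>I. \<forall>k\<in>I. \<epsilon> \<le> pdist (lam j) (lam k) \<longrightarrow> \<delta> \<le> pdist (mu j) (mu k)"
    and "pd_separated I lam"
  shows "pd_separated I mu"
  using assms unfolding pd_separated_def by meson

proposition carleson_seq_bounded_displacement:
  assumes \<Phi>: "\<Phi> ` unit_disc \<subseteq> unit_disc"
    and K: "0 \<le> K" "\<And>z. z \<in> unit_disc \<Longrightarrow> disc_close K z (\<Phi> z)"
    and sep: "\<And>\<epsilon>. 0 < \<epsilon> \<Longrightarrow> \<exists>\<delta>>0. \<forall>z\<in>unit_disc. \<forall>w\<in>unit_disc.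
        \<epsilon> \<le> pdist z w \<longrightarrow> \<delta> \<le> pdist (\<Phi> z) (\<Phi> w)"
    and sep': "\<And>\<epsilon>. 0 < \<epsilon> \<Longrightarrow> \<exists>\<delta>>0. \<forall>z\<in>unit_disc. \<forall>w\<in>unit_disc.
        \<epsilon> \<le> pdist (\<Phi> z) (\<Phi> w) \<longrightarrow> \<delta> \<le> pdist z w"
    and lam: "lam ` I \<subseteq> unit_disc"
  shows "carleson_seq I lam \<longleftrightarrow> carleson_seq I (\<lambda>j. \<Phi> (lam j))"
proof -
  have D: "lam j \<in> unit_disc" "\<Phi> (lam j) \<in> unit_disc" if "j \<in> I" for j
    using that lam \<Phi> by blast+
  have "pd_separated I lam \<longleftrightarrow> pd_separated I (\<lambda>j. \<Phi> (lam j))"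
  proof
    show "pd_separated I lam \<Longrightarrow> pd_separated I (\<lambda>j. \<Phi> (lam j))"
      by (erule pd_separated_image[rotated]) (use sep D in meson)
    show "pd_separated I (\<lambda>j. \<Phi> (lam j)) \<Longrightarrow> pd_separated I lam"
      by (erule pd_separated_image[rotated]) (use sep' D in meson)
  qed
  moreover have "corr_bounded I lam \<longleftrightarrow> corr_bounded I (\<lambda>j. \<Phi> (lam j))"
  proof
    show "corr_bounded I lam \<Longrightarrow> corr_bounded I (\<lambda>j. \<Phi> (lam j))"
      by (erule corr_bounded_disc_close[OF K(1), rotated]) (use K(2) D in blast)
    show "corr_bounded I (\<lambda>j. \<Phi> (lam j)) \<Longrightarrow> corr_bounded I lam"
      by (erule corr_bounded_disc_close[OF K(1), rotated]) (use K(2) D disc_close_commute in blast)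
  qed
  moreover have "(\<lambda>j. \<Phi> (lam j)) ` I \<subseteq> unit_disc" using D by blast
  ultimately show ?thesis using carleson_interpolation lam by blast
qed

section \<open>The boundary differential as a real linear map\<close>

text \<open>The differential at \<open>\<zeta>\<close> of the model map \<open>(1 - t) \<zeta> \<mapsto> \<zeta> - t v(\<zeta>)\<close>: it fixes the
  tangential direction \<open>\<i> \<zeta>\<close> and sends the normal \<open>\<zeta>\<close> to \<open>v(\<zeta>)\<close>.\<close>
definition layer_differential :: "(complex \<Rightarrow> complex) \<Rightarrow> complex \<Rightarrow> complex \<Rightarrow> complex" where
  "layer_differential v \<zeta> h = h + of_real (Re (cnj \<zeta> * h)) * (v \<zeta> - \<zeta>)"

lemma bounded_linear_layer_differential: "bounded_linear (layer_differential v \<zeta>)"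
  unfolding layer_differential_def[abs_def]
  by (intro bounded_linear_add bounded_linear_ident bounded_linear_mult_const
        bounded_linear_compose[OF bounded_linear_of_real]
        bounded_linear_compose[OF bounded_linear_Re] bounded_linear_mult_right)

text \<open>The coefficient \<open>Re (cnj \<zeta> h)\<close> is recovered from \<open>D h\<close> through
  \<open>Re (cnj \<zeta> D h) = a(\<zeta>) Re (cnj \<zeta> h)\<close>.\<close>
lemma layer_differential_lower:
  assumes "cmod \<zeta> = 1" "0 < boundary_coeff v \<zeta>"
  shows "cmod h \<le> (1 + cmod (v \<zeta> - \<zeta>) / boundary_coeff v \<zeta>) * cmod (layer_differential v \<zeta> h)"
proof -
  define R where "R = Re (cnj \<zeta> * h)"
  define d where "d = layer_differential v \<zeta> h"
  have zz: "cnj \<zeta> * \<zeta> = 1" using assms(1) complex_norm_square[of \<zeta>] by (simp add: mult.commute)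
  have "cnj \<zeta> * d = cnj \<zeta> * h + of_real R * (cnj \<zeta> * v \<zeta> - cnj \<zeta> * \<zeta>)"
    unfolding d_def layer_differential_def R_def[symmetric] by (simp only: ring_distribs mult_ac)
  hence "cnj \<zeta> * d = cnj \<zeta> * h + of_real R * (cnj \<zeta> * v \<zeta> - 1)" by (simp only: zz)
  hence "Re (cnj \<zeta> * d) = R + R * (boundary_coeff v \<zeta> - 1)"
    by (simp add: R_def boundary_coeff_def)
  hence "R * boundary_coeff v \<zeta> = Re (cnj \<zeta> * d)" by (simp add: algebra_simps)
  hence "\<bar>R\<bar> * boundary_coeff v \<zeta> \<le> cmod d"
    using abs_Re_le_cmod[of "cnj \<zeta> * d"] assms by (simp add: norm_mult abs_mult[symmetric])
  hence R: "\<bar>R\<bar> \<le> cmod d / boundary_coeff v \<zeta>" using assms(2) by (simp add: field_simps)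
  have "h = d - of_real R * (v \<zeta> - \<zeta>)" by (simp add: d_def layer_differential_def R_def)
  hence "cmod h \<le> cmod d + \<bar>R\<bar> * cmod (v \<zeta> - \<zeta>)"
    by (metis norm_mult norm_of_real norm_triangle_ineq4)
  also have "\<dots> \<le> cmod d + cmod d / boundary_coeff v \<zeta> * cmod (v \<zeta> - \<zeta>)"
    using R by (intro add_left_mono mult_right_mono) auto
  finally show ?thesis by (simp add: d_def algebra_simps)
qed

lemma layer_differential_upper:
  assumes "cmod \<zeta> = 1"
  shows "cmod (layer_differential v \<zeta> h) \<le> (1 + cmod (v \<zeta> - \<zeta>)) * cmod h"
proof -
  have "cmod (layer_differential v \<zeta> h) \<le> cmod h + \<bar>Re (cnj \<zeta> * h)\<bar> * cmod (v \<zeta> - \<zeta>)"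
    unfolding layer_differential_def by (metis norm_mult norm_of_real norm_triangle_ineq)
  also have "\<dots> \<le> cmod h + cmod h * cmod (v \<zeta> - \<zeta>)"
    using abs_Re_le_cmod[of "cnj \<zeta> * h"] assms
    by (intro add_left_mono mult_right_mono) (auto simp: norm_mult)
  finally show ?thesis by (simp add: algebra_simps)
qed

lemma real_det_layer_differential:
  assumes "cmod \<zeta> = 1"
  shows "real_det (layer_differential v \<zeta>) = boundary_coeff v \<zeta>"
proof -
  define c where "c = v \<zeta> - \<zeta>"
  have zz: "(Re \<zeta>)\<^sup>2 + (Im \<zeta>)\<^sup>2 = 1" using assms cmod_power2[of \<zeta>] by simp
  have 1: "layer_differential v \<zeta> 1 = Complex (1 + Re \<zeta> * Re c) (Re \<zeta> * Im c)"
    by (simp add: layer_differential_def c_def complex_eq_iff)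
  have i: "layer_differential v \<zeta> \<i> = Complex (Im \<zeta> * Re c) (1 + Im \<zeta> * Im c)"
    by (simp add: layer_differential_def c_def complex_eq_iff)
  have c1: "Complex 1 0 = 1" and ci: "Complex 0 1 = \<i>" by (simp_all add: complex_eq_iff)
  have "real_det (layer_differential v \<zeta>) =
      (1 + Re \<zeta> * Re c) * (1 + Im \<zeta> * Im c) - (Im \<zeta> * Re c) * (Re \<zeta> * Im c)"
    by (simp add: real_det_def det_2 matrix_def axis_def c1 ci 1 i Let_def)
  also have "\<dots> = 1 + Re (cnj \<zeta> * c)" by (simp add: algebra_simps)
  also have "\<dots> = boundary_coeff v \<zeta>"
    using zz by (simp add: c_def boundary_coeff_def power2_eq_square algebra_simps)
  finally show ?thesis .
qed

text \<open>The difference of two derivatives vanishes on each direction that points into the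
  closed disc, and the directions \<open>- \<zeta>\<close> and \<open>(-1 + \<i>) \<zeta>\<close> span the plane.\<close>
lemma disc_derivative_unique:
  fixes f :: "complex \<Rightarrow> complex"
  assumes \<zeta>: "cmod \<zeta> = 1"
    and "(f has_derivative L1) (at \<zeta> within closed_disc)" "(f has_derivative L2) (at \<zeta> within closed_disc)"
  shows "L1 = L2"
proof -
  define L where "L = (\<lambda>h. L1 h - L2 h)"
  have "((\<lambda>z. f z - f z) has_derivative L) (at \<zeta> within closed_disc)"
    unfolding L_def by (intro derivative_intros assms)
  hence "((\<lambda>z. 0) has_derivative L) (at \<zeta> within closed_disc)" by simp
  hence lin: "bounded_linear L"
    and small: "\<And>e. 0 < e \<Longrightarrow> \<exists>d>0. \<forall>y\<in>closed_disc. cmod (y - \<zeta>) < d \<longrightarrow> cmod (L (y - \<zeta>)) \<le> e * cmod (y - \<zeta>)"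
    unfolding has_derivative_within_alt by simp_all
  interpret L: bounded_linear L by (rule lin)
  have ray: "L u = 0" if u: "\<And>s. 0 < s \<Longrightarrow> s \<le> 1 \<Longrightarrow> \<zeta> + of_real s * u \<in> closed_disc" for u
  proof -
    have "cmod (L u) \<le> 0 + e" if e: "0 < e" for e
    proof -
      obtain d where d: "0 < d" "\<And>y. y \<in> closed_disc \<Longrightarrow> cmod (y - \<zeta>) < d \<Longrightarrow>
          cmod (L (y - \<zeta>)) \<le> e / (cmod u + 1) * cmod (y - \<zeta>)"
        using small[of "e / (cmod u + 1)"] e by (auto simp: add_nonneg_pos)
      define s where "s = min 1 (d / (2 * (cmod u + 1)))"
      have s: "0 < s" "s \<le> 1" using d(1) by (auto simp: s_def add_nonneg_pos)
      have "s * cmod u \<le> d / (2 * (cmod u + 1)) * (cmod u + 1)"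
        using s by (intro mult_mono) (auto simp: s_def)
      also have "\<dots> = d / 2" by (simp add: field_simps add_nonneg_eq_0_iff)
      finally have "cmod (of_real s * u) < d" using d(1) s by (simp add: norm_mult)
      hence "cmod (L (of_real s * u)) \<le> e / (cmod u + 1) * cmod (of_real s * u)"
        using d(2)[OF u[OF s]] by simp
      hence "s * cmod (L u) \<le> e / (cmod u + 1) * (s * cmod u)"
        using s by (simp add: scaleR_conv_of_real[symmetric] L.scaleR)
      hence "s * cmod (L u) \<le> s * (e / (cmod u + 1) * cmod u)" by (simp only: mult_ac)
      hence "cmod (L u) \<le> e / (cmod u + 1) * cmod u" using s(1) by (simp only: mult_le_cancel_left_pos)
      also have "\<dots> \<le> e / (cmod u + 1) * (cmod u + 1)" using e by (intro mult_left_mono) auto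
      also have "\<dots> = e" by (simp add: add_nonneg_eq_0_iff)
      finally show ?thesis by simp
    qed
    thus ?thesis using field_le_epsilon[of "cmod (L u)" 0] by simp
  qed
  have "L (- \<zeta>) = 0"
  proof (rule ray)
    fix s :: real assume s: "0 < s" "s \<le> 1"
    have "\<zeta> + of_real s * - \<zeta> = of_real (1 - s) * \<zeta>" by (simp add: algebra_simps)
    hence "cmod (\<zeta> + of_real s * - \<zeta>) = \<bar>1 - s\<bar> * 1" by (simp only: norm_mult norm_of_real \<zeta>)
    thus "\<zeta> + of_real s * - \<zeta> \<in> closed_disc" using s by (simp add: dist_norm norm_minus_commute)
  qed
  moreover have "L ((-1 + \<i>) * \<zeta>) = 0"
  proof (rule ray)
    fix s :: real assume s: "0 < s" "s \<le> 1"
    have "\<zeta> + of_real s * ((-1 + \<i>) * \<zeta>) = Complex (1 - s) s * \<zeta>"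
      by (simp add: complex_eq_iff algebra_simps)
    hence "cmod (\<zeta> + of_real s * ((-1 + \<i>) * \<zeta>)) = sqrt ((1 - s)\<^sup>2 + s\<^sup>2)"
      using \<zeta> by (simp add: norm_mult complex_norm)
    also have "\<dots> \<le> 1"
    proof -
      have "s * s \<le> 1 * s" using s by (intro mult_right_mono) auto
      thus ?thesis by (simp add: power2_eq_square algebra_simps)
    qed
    finally show "\<zeta> + of_real s * ((-1 + \<i>) * \<zeta>) \<in> closed_disc" by simp
  qed
  moreover have "h = (Im (h / \<zeta>)) *\<^sub>R ((-1 + \<i>) * \<zeta>) + (- Re (h / \<zeta>) - Im (h / \<zeta>)) *\<^sub>R (- \<zeta>)" for h
  proof -
    have "h = of_real (Re (h / \<zeta>)) * \<zeta> + of_real (Im (h / \<zeta>)) * \<i> * \<zeta>"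
    proof -
      have "h = (h / \<zeta>) * \<zeta>" using \<zeta> by auto
      thus ?thesis by (metis complex_eq distrib_right mult.commute)
    qed
    thus ?thesis by (simp add: scaleR_conv_of_real algebra_simps)
  qed
  ultimately have "L h = 0" for h by (metis L.add L.scaleR add_0 scaleR_zero_right)
  thus ?thesis by (auto simp: L_def fun_eq_iff)
qed

text \<open>The chord slope of the modulus is \<open>(z + w) / (|z| + |w|)\<close>, which is close to \<open>\<zeta>\<close>.\<close>
lemma cmod_diff_linearised:
  assumes \<zeta>: "cmod \<zeta> = 1" and d: "d \<le> 1 / 2"
    and z: "cmod (z - \<zeta>) < d" and w: "cmod (w - \<zeta>) < d"
  shows "\<bar>cmod z - cmod w - Re (cnj \<zeta> * (z - w))\<bar> \<le> 4 * d * cmod (z - w)"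
proof -
  define p where "p = cmod z + cmod w"
  define m where "m = z + w - of_real p * \<zeta>"
  have zc: "\<bar>cmod z - 1\<bar> < d" "\<bar>cmod w - 1\<bar> < d"
    using norm_triangle_ineq3[of z \<zeta>] norm_triangle_ineq3[of w \<zeta>] z w \<zeta> by auto
  have p: "1 \<le> p" using zc d by (simp add: p_def)
  have "m = (z - \<zeta>) + (w - \<zeta>) + of_real (1 - cmod z) * \<zeta> + of_real (1 - cmod w) * \<zeta>"
    by (simp add: m_def p_def algebra_simps)
  hence "cmod m \<le> cmod (z - \<zeta>) + cmod (w - \<zeta>) + cmod (of_real (1 - cmod z) * \<zeta>) + cmod (of_real (1 - cmod w) * \<zeta>)"
    by (metis (no_types, lifting) norm_triangle_ineq norm_triangle_mono order_refl)
  also have "\<dots> = cmod (z - \<zeta>) + cmod (w - \<zeta>) + \<bar>1 - cmod z\<bar> + \<bar>1 - cmod w\<bar>"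
    by (simp only: norm_mult norm_of_real \<zeta> mult_1_right)
  finally have m: "cmod m \<le> 4 * d" using z w zc by (simp add: abs_minus_commute)
  have "(cmod z - cmod w) * p = (cmod z)\<^sup>2 - (cmod w)\<^sup>2"
    by (simp add: p_def power2_eq_square algebra_simps)
  also have "\<dots> = Re (cnj (z + w) * (z - w))"
    unfolding cmod_power2 by (simp add: power2_eq_square algebra_simps)
  also have "z + w = m + of_real p * \<zeta>" by (simp add: m_def)
  finally have "(cmod z - cmod w - Re (cnj \<zeta> * (z - w))) * p = Re (cnj m * (z - w))"
    by (simp add: algebra_simps)
  hence "\<bar>cmod z - cmod w - Re (cnj \<zeta> * (z - w))\<bar> * p \<le> cmod m * cmod (z - w)"
    using abs_Re_le_cmod[of "cnj m * (z - w)"] p by (simp add: norm_mult abs_mult[symmetric])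
  moreover have "\<bar>cmod z - cmod w - Re (cnj \<zeta> * (z - w))\<bar> * 1
      \<le> \<bar>cmod z - cmod w - Re (cnj \<zeta> * (z - w))\<bar> * p" using p by (intro mult_left_mono) auto
  ultimately show ?thesis using mult_right_mono[OF m, of "cmod (z - w)"] by simp
qed

section \<open>Estimates at the scale of the distance to the circle\<close>

text \<open>By compactness, a sequence of counterexamples would accumulate at some point of the closed
  disc. At a point of the circle this contradicts the local hypothesis; at an interior point the
  scale \<open>1 - |z|\<^sup>2\<close> stays away from zero, and the hypothesis without the scale applies.\<close>
lemma disc_to_boundary_estimate:
  fixes A B :: "complex \<Rightarrow> complex \<Rightarrow> real"
  assumes unif: "\<And>\<epsilon>. 0 < \<epsilon> \<Longrightarrow> \<exists>\<delta>>0. \<forall>z\<in>unit_disc. \<forall>w\<in>unit_disc. A z w \<le> \<delta> \<longrightarrow> B z w \<le> \<epsilon>"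
    and loc: "\<And>\<zeta>. \<zeta> \<in> unit_circ \<Longrightarrow> \<exists>d>0. \<exists>\<delta>>0. \<forall>z\<in>unit_disc. \<forall>w\<in>unit_disc.
        cmod (z - \<zeta>) < d \<longrightarrow> A z w \<le> \<delta> * (1 - (cmod z)\<^sup>2) \<longrightarrow> B z w \<le> \<epsilon> * (1 - (cmod z)\<^sup>2)"
    and \<epsilon>: "0 < \<epsilon>"
  shows "\<exists>\<delta>>0. \<forall>z\<in>unit_disc. \<forall>w\<in>unit_disc.
        A z w \<le> \<delta> * (1 - (cmod z)\<^sup>2) \<longrightarrow> B z w \<le> \<epsilon> * (1 - (cmod z)\<^sup>2)"
proof (rule ccontr)
  assume neg: "\<not> ?thesis"
  have "\<exists>z w. z \<in> unit_disc \<and> w \<in> unit_disc \<and> A z w \<le> inverse (real (Suc n)) * (1 - (cmod z)\<^sup>2) \<and>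
      \<epsilon> * (1 - (cmod z)\<^sup>2) < B z w" for n
    using neg inverse_Suc[of n] by (metis linorder_not_le of_nat_0_less_iff positive_imp_inverse_positive zero_less_Suc)
  then obtain z w where zw: "\<And>n. z n \<in> unit_disc" "\<And>n. w n \<in> unit_disc"
      "\<And>n. A (z n) (w n) \<le> inverse (real (Suc n)) * (1 - (cmod (z n))\<^sup>2)"
      "\<And>n. \<epsilon> * (1 - (cmod (z n))\<^sup>2) < B (z n) (w n)" by metis
  have small: "\<forall>\<^sub>F n in sequentially. inverse (real (Suc n)) < \<delta>" if "0 < \<delta>" for \<delta>
    using order_tendstoD(2)[OF LIMSEQ_inverse_real_of_nat that] .
  have "\<forall>n. z n \<in> closed_disc" using zw(1) by (simp add: less_imp_le)
  then obtain x r where x: "x \<in> closed_disc" "strict_mono (r :: nat \<Rightarrow> nat)" "(z \<circ> r) \<longlonglongrightarrow> x"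
    using compact_cball[of "0::complex" 1] unfolding compact_def by blast
  have small_r: "\<forall>\<^sub>F n in sequentially. inverse (real (Suc (r n))) < \<delta>" if "0 < \<delta>" for \<delta>
    using eventually_subseq[OF x(2) small[OF that]] .
  show False
  proof (cases "cmod x = 1")
    case True
    then obtain d \<delta> where d: "0 < d" "0 < \<delta>" "\<And>z w. z \<in> unit_disc \<Longrightarrow> w \<in> unit_disc \<Longrightarrow> cmod (z - x) < d \<Longrightarrow>
        A z w \<le> \<delta> * (1 - (cmod z)\<^sup>2) \<Longrightarrow> B z w \<le> \<epsilon> * (1 - (cmod z)\<^sup>2)"
      using loc[of x] by (auto simp del: mem_ball_0)
    have "\<forall>\<^sub>F n in sequentially. cmod (z (r n) - x) < d"
      using tendstoD[OF x(3) d(1)] by (simp add: dist_norm)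
    then obtain n where n: "cmod (z (r n) - x) < d" "inverse (real (Suc (r n))) < \<delta>"
      using eventually_happens[OF eventually_conj[OF _ small_r[OF d(2)]]] by auto
    have "A (z (r n)) (w (r n)) \<le> \<delta> * (1 - (cmod (z (r n)))\<^sup>2)"
      using zw(3)[of "r n"] n(2) one_minus_cmod_sq_pos[OF zw(1)[of "r n"]]
      by (meson less_imp_le mult_right_mono order_trans)
    thus False using d(3)[OF zw(1) zw(2) n(1)] zw(4)[of "r n"] by fastforce
  next
    case False
    define c where "c = (1 - (cmod x)\<^sup>2) / 2"
    have c: "0 < c" using False x(1) one_minus_cmod_sq_pos[of x] by (simp add: c_def)
    obtain \<delta> where \<delta>: "0 < \<delta>" "\<And>z w. z \<in> unit_disc \<Longrightarrow> w \<in> unit_disc \<Longrightarrow> A z w \<le> \<delta> \<Longrightarrow> B z w \<le> \<epsilon> * c"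
      using unif[of "\<epsilon> * c"] \<epsilon> c by (auto simp del: mem_ball_0)
    have "(\<lambda>n. 1 - (cmod (z (r n)))\<^sup>2) \<longlonglongrightarrow> 1 - (cmod x)\<^sup>2"
      using x(3) unfolding o_def by (intro tendsto_intros)
    hence "\<forall>\<^sub>F n in sequentially. c < 1 - (cmod (z (r n)))\<^sup>2"
      using c by (intro order_tendstoD(1)) (auto simp: c_def)
    then obtain n where n: "c < 1 - (cmod (z (r n)))\<^sup>2" "inverse (real (Suc (r n))) < \<delta>"
      using eventually_happens[OF eventually_conj[OF _ small_r[OF \<delta>(1)]]] by auto
    have "A (z (r n)) (w (r n)) \<le> inverse (real (Suc (r n))) * 1"
      by (rule order_trans[OF zw(3)]) (intro mult_left_mono, auto)
    hence "B (z (r n)) (w (r n)) \<le> \<epsilon> * c" using n(2) by (intro \<delta>(2) zw) simp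
    also have "\<dots> \<le> \<epsilon> * (1 - (cmod (z (r n)))\<^sup>2)" using n(1) \<epsilon> by simp
    finally show False using zw(4)[of "r n"] by simp
  qed
qed

section \<open>Homeomorphisms with a first order boundary expansion\<close>

locale boundary_expansion =
  fixes \<Psi> v :: "complex \<Rightarrow> complex"
  assumes homeo: "\<exists>\<Psi>'. homeomorphism closed_disc closed_disc \<Psi> \<Psi>'"
    and bdry: "\<forall>\<zeta>\<in>unit_circ. \<Psi> \<zeta> = \<zeta>"
    and expansion: "uniform_boundary_expansion \<Psi> v"
begin

lemma cont: "continuous_on closed_disc \<Psi>"
  and maps_closed: "z \<in> closed_disc \<Longrightarrow> \<Psi> z \<in> closed_disc"
  and cont_v: "continuous_on unit_circ v"
  using expansion unfolding uniform_boundary_expansion_def by blast+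

lemma inj: "inj_on \<Psi> closed_disc"
  using homeo by (auto simp: homeomorphism_def intro: inj_on_inverseI)

text \<open>A point of the open disc cannot go to the circle, because \<open>\<Psi>\<close> is injective and already
  maps each point of the circle to itself.\<close>
lemma maps_disc: "z \<in> unit_disc \<Longrightarrow> \<Psi> z \<in> unit_disc"
proof (rule ccontr)
  assume z: "z \<in> unit_disc" and "\<Psi> z \<notin> unit_disc"
  hence circ: "\<Psi> z \<in> unit_circ" using maps_closed[of z] by auto
  hence "\<Psi> (\<Psi> z) = \<Psi> z" using bdry by blast
  hence "\<Psi> z = z" by (rule inj_onD[OF inj]) (use z maps_closed in auto)
  thus False using z circ by simp
qed

lemma v_bounded: obtains V where "0 \<le> V" "\<And>\<zeta>. \<zeta> \<in> unit_circ \<Longrightarrow> cmod (v \<zeta>) \<le> V"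
proof -
  have "bounded (v ` unit_circ)"
    by (intro compact_imp_bounded compact_continuous_image cont_v) simp
  then obtain V where "0 < V" "\<forall>x\<in>v ` unit_circ. cmod x \<le> V" unfolding bounded_pos by blast
  thus thesis using that[of V] by auto
qed

text \<open>Pointwise form of the expansion. The supremum in its definition has to be shown to run
  over a bounded set before it gives information about single points; at \<open>t = 0\<close> the boundary
  values are used.\<close>
lemma expansion_bound:
  assumes \<epsilon>: "0 < \<epsilon>"
  obtains d where "0 < d" "d \<le> 1" "\<And>t \<zeta>. 0 \<le> t \<Longrightarrow> t < d \<Longrightarrow> \<zeta> \<in> unit_circ \<Longrightarrow>
    cmod (\<Psi> (of_real (1 - t) * \<zeta>) - \<zeta> + of_real t * v \<zeta>) \<le> \<epsilon> * t"
proof -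
  obtain V where V: "0 \<le> V" "\<And>\<zeta>. \<zeta> \<in> unit_circ \<Longrightarrow> cmod (v \<zeta>) \<le> V" by (rule v_bounded) blast
  let ?E = "\<lambda>t \<zeta>. cmod (\<Psi> (of_real (1 - t) * \<zeta>) - \<zeta> + of_real t * v \<zeta>)"
  have "((\<lambda>t. SUP \<zeta>\<in>unit_circ. ?E t \<zeta> / t) \<longlongrightarrow> 0) (at_right 0)"
    using expansion by (simp add: uniform_boundary_expansion_def)
  from order_tendstoD(2)[OF this \<epsilon>] obtain d where d: "0 < d"
      "\<And>t. 0 < t \<Longrightarrow> t < d \<Longrightarrow> (SUP \<zeta>\<in>unit_circ. ?E t \<zeta> / t) < \<epsilon>"
    unfolding eventually_at_right_field by auto
  show thesis
  proof (rule that[of "min d 1"])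
    fix t :: real and \<zeta> assume t: "0 \<le> t" "t < min d 1" and \<zeta>: "\<zeta> \<in> unit_circ"
    show "?E t \<zeta> \<le> \<epsilon> * t"
    proof (cases "t = 0")
      case True
      thus ?thesis using bdry \<zeta> by simp
    next
      case False
      hence t0: "0 < t" using t by simp
      have "bdd_above ((\<lambda>\<zeta>. ?E t \<zeta> / t) ` unit_circ)"
      proof (rule bdd_aboveI2)
        fix \<eta> assume \<eta>: "\<eta> \<in> unit_circ"
        have "of_real (1 - t) * \<eta> \<in> closed_disc"
          using \<eta> t t0 by (simp add: norm_mult del: of_real_diff)
        from maps_closed[OF this] have "cmod (\<Psi> (of_real (1 - t) * \<eta>)) \<le> 1" by simp
        hence "?E t \<eta> \<le> 1 + 1 + t * V"
          using V(2)[OF \<eta>] \<eta> t0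
          by (intro norm_triangle_mono[OF order_trans[OF norm_triangle_ineq4]]) (auto simp: norm_mult)
        thus "?E t \<eta> / t \<le> (1 + 1 + t * V) / t" using t0 by (intro divide_right_mono) auto
      qed
      hence "?E t \<zeta> / t \<le> (SUP \<zeta>\<in>unit_circ. ?E t \<zeta> / t)" using \<zeta> by (intro cSUP_upper)
      also have "\<dots> < \<epsilon>" using d t t0 by simp
      finally show ?thesis using t0 by (simp add: field_simps)
    qed
  qed (use d in auto)
qed

text \<open>Writing \<open>z = (1 - t) \<zeta>\<close> and \<open>w = (1 - s) \<eta>\<close>, the error splits into the two expansion
  errors at \<open>z\<close> and \<open>w\<close>, the variation of \<open>\<zeta> - v(\<zeta>)\<close> near \<open>\<zeta>\<^sub>0\<close> multiplied by \<open>t\<close> and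
  \<open>s\<close>, and the error of linearising \<open>|z| - |w| = s - t\<close>.\<close>
lemma strict_differential:
  assumes \<zeta>: "\<zeta>\<^sub>0 \<in> unit_circ" and \<epsilon>: "0 < \<epsilon>"
  obtains d where "0 < d" "\<And>z w. z \<in> closed_disc \<Longrightarrow> w \<in> closed_disc \<Longrightarrow>
    cmod (z - \<zeta>\<^sub>0) < d \<Longrightarrow> cmod (w - \<zeta>\<^sub>0) < d \<Longrightarrow>
    cmod (\<Psi> z - \<Psi> w - layer_differential v \<zeta>\<^sub>0 (z - w))
      \<le> \<epsilon> * ((1 - cmod z) + (1 - cmod w) + cmod (z - w))"
proof -
  define \<epsilon>' where "\<epsilon>' = \<epsilon> / 2"
  define B where "B = cmod (\<zeta>\<^sub>0 - v \<zeta>\<^sub>0)"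
  have \<epsilon>': "0 < \<epsilon>'" using \<epsilon> by (simp add: \<epsilon>'_def)
  have \<zeta>1: "cmod \<zeta>\<^sub>0 = 1" using \<zeta> by simp
  obtain d1 where d1: "0 < d1" "\<And>t \<zeta>. 0 \<le> t \<Longrightarrow> t < d1 \<Longrightarrow> \<zeta> \<in> unit_circ \<Longrightarrow>
      cmod (\<Psi> (of_real (1 - t) * \<zeta>) - \<zeta> + of_real t * v \<zeta>) \<le> \<epsilon>' * t"
    by (rule expansion_bound[OF \<epsilon>']) blast
  have "continuous_on unit_circ (\<lambda>\<zeta>. \<zeta> - v \<zeta>)" by (intro continuous_intros cont_v)
  then obtain d2 where d2: "0 < d2" "\<And>\<zeta>. \<zeta> \<in> unit_circ \<Longrightarrow> cmod (\<zeta> - \<zeta>\<^sub>0) < d2 \<Longrightarrow>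
      cmod ((\<zeta> - v \<zeta>) - (\<zeta>\<^sub>0 - v \<zeta>\<^sub>0)) < \<epsilon>'"
    using \<epsilon>' \<zeta> unfolding continuous_on_iff dist_norm by meson
  \<comment> \<open>The bound by \<open>d2 / 2\<close> accounts for the passage from \<open>z\<close> to \<open>sgn z\<close>, which at most doubles
    the distance to \<open>\<zeta>\<^sub>0\<close>; the last bound makes the linearisation error \<open>4 d B |z - w|\<close> small.\<close>
  define d where "d = min (min (1 / 2) d1) (min (d2 / 2) (\<epsilon> / (4 * (B + 1))))"
  have B: "0 \<le> B" by (simp add: B_def)
  have "0 < d" using d1(1) d2(1) \<epsilon> B by (simp add: d_def)
  moreover have "d \<le> 1 / 2" "d \<le> d1" "d \<le> d2 / 2" "d \<le> \<epsilon> / (4 * (B + 1))"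
    unfolding d_def by linarith+
  ultimately have d: "0 < d" "d \<le> 1 / 2" "d \<le> d1" "2 * d \<le> d2" "d \<le> \<epsilon> / (4 * (B + 1))" by simp_all
  hence "d * (4 * (B + 1)) \<le> \<epsilon>" using B by (simp add: field_simps)
  hence dB: "4 * d * B \<le> \<epsilon>" using d(1) by (simp add: algebra_simps)
  have point: "cmod (\<Psi> z - \<zeta> + of_real t * v \<zeta>) \<le> \<epsilon>' * t \<and> \<zeta> - z = of_real t * \<zeta> \<and>
      cmod (of_real t * ((\<zeta> - v \<zeta>) - (\<zeta>\<^sub>0 - v \<zeta>\<^sub>0))) \<le> \<epsilon>' * t"
    if z: "z \<in> closed_disc" "cmod (z - \<zeta>\<^sub>0) < d" and t: "t = 1 - cmod z" and s: "\<zeta> = sgn z" for z \<zeta> t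
  proof -
    have t0: "0 \<le> t" using z t by simp
    have td: "t < d" using norm_triangle_ineq3[of z \<zeta>\<^sub>0] z t \<zeta>1 by simp
    hence z0: "z \<noteq> 0" using t d by auto
    have zt: "of_real (1 - t) * \<zeta> = z" and s1: "\<zeta> \<in> unit_circ"
      using z0 t s by (auto simp: sgn_eq norm_divide)
    hence zz: "\<zeta> - z = of_real t * \<zeta>" by (metis add_diff_cancel_left' diff_add_cancel left_diff_distrib mult_1 of_real_1 of_real_diff diff_diff_eq2)
    have "cmod (\<zeta> - \<zeta>\<^sub>0) \<le> cmod (\<zeta> - z) + cmod (z - \<zeta>\<^sub>0)"
      using norm_triangle_ineq[of "\<zeta> - z" "z - \<zeta>\<^sub>0"] by simp
    also have "cmod (\<zeta> - z) = t" using s1 t0 by (simp add: zz norm_mult)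
    finally have "cmod (\<zeta> - \<zeta>\<^sub>0) < d2" using td z d by simp
    from d2(2)[OF s1 this] have "cmod (of_real t * ((\<zeta> - v \<zeta>) - (\<zeta>\<^sub>0 - v \<zeta>\<^sub>0))) \<le> t * \<epsilon>'"
      using t0 unfolding norm_mult by (intro mult_mono) auto
    thus ?thesis using d1(2)[OF t0 _ s1] td d zz zt by (simp add: mult.commute)
  qed
  show thesis
  proof (rule that[OF d(1)])
    fix z w assume z: "z \<in> closed_disc" "cmod (z - \<zeta>\<^sub>0) < d" and w: "w \<in> closed_disc" "cmod (w - \<zeta>\<^sub>0) < d"
    define t \<zeta> s \<eta> where "t = 1 - cmod z" and "\<zeta> = sgn z" and "s = 1 - cmod w" and "\<eta> = sgn w"
    note pz = point[OF z t_def \<zeta>_def] and pw = point[OF w s_def \<eta>_def]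
    define R where "R = Re (cnj \<zeta>\<^sub>0 * (z - w))"
    define e1 e2 e3 e4 e5 where "e1 = \<Psi> z - \<zeta> + of_real t * v \<zeta>"
      and "e2 = \<Psi> w - \<eta> + of_real s * v \<eta>"
      and "e3 = of_real t * ((\<zeta> - v \<zeta>) - (\<zeta>\<^sub>0 - v \<zeta>\<^sub>0))"
      and "e4 = of_real s * ((\<eta> - v \<eta>) - (\<zeta>\<^sub>0 - v \<zeta>\<^sub>0))"
      and "e5 = of_real (t - s + R) * (\<zeta>\<^sub>0 - v \<zeta>\<^sub>0)"
    have "z = \<zeta> - of_real t * \<zeta>" "w = \<eta> - of_real s * \<eta>" using pz pw by (auto simp: algebra_simps)
    hence "\<Psi> z - \<Psi> w - layer_differential v \<zeta>\<^sub>0 (z - w) = e1 - e2 + e3 - e4 + e5"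
      unfolding layer_differential_def R_def[symmetric] e1_def e2_def e3_def e4_def e5_def
      by (simp add: algebra_simps)
    hence "cmod (\<Psi> z - \<Psi> w - layer_differential v \<zeta>\<^sub>0 (z - w))
        \<le> cmod e1 + cmod e2 + cmod e3 + cmod e4 + cmod e5"
      using norm_triangle_ineq[of "e1 - e2 + e3 - e4" e5] norm_triangle_ineq4[of "e1 - e2 + e3" e4]
        norm_triangle_ineq[of "e1 - e2" e3] norm_triangle_ineq4[of e1 e2] by simp
    also have "\<dots> \<le> \<epsilon>' * t + \<epsilon>' * s + \<epsilon>' * t + \<epsilon>' * s + \<epsilon> * cmod (z - w)"
    proof (intro add_mono)
      have "\<bar>t - s + R\<bar> \<le> 4 * d * cmod (z - w)"
        using cmod_diff_linearised[OF \<zeta>1 d(2) z(2) w(2)] by (simp add: t_def s_def R_def)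
      hence "cmod e5 \<le> 4 * d * cmod (z - w) * B"
        unfolding e5_def B_def norm_mult norm_of_real by (intro mult_right_mono) auto
      also have "\<dots> = (4 * d * B) * cmod (z - w)" by simp
      also have "\<dots> \<le> \<epsilon> * cmod (z - w)" by (intro mult_right_mono dB) simp
      finally show "cmod e5 \<le> \<epsilon> * cmod (z - w)" .
    qed (use pz pw in \<open>auto simp: e1_def e2_def e3_def e4_def\<close>)
    also have "\<dots> = \<epsilon> * ((1 - cmod z) + (1 - cmod w) + cmod (z - w))"
      by (simp add: \<epsilon>'_def t_def s_def algebra_simps)
    finally show "cmod (\<Psi> z - \<Psi> w - layer_differential v \<zeta>\<^sub>0 (z - w))
      \<le> \<epsilon> * ((1 - cmod z) + (1 - cmod w) + cmod (z - w))" .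
  qed
qed

lemma has_boundary_derivative:
  assumes "\<zeta> \<in> unit_circ"
  shows "(\<Psi> has_derivative layer_differential v \<zeta>) (at \<zeta> within closed_disc)"
  unfolding has_derivative_within_alt
proof (intro conjI allI impI bounded_linear_layer_differential)
  fix e :: real assume "0 < e"
  then obtain d where d: "0 < d" "\<And>z w. z \<in> closed_disc \<Longrightarrow> w \<in> closed_disc \<Longrightarrow>
      cmod (z - \<zeta>) < d \<Longrightarrow> cmod (w - \<zeta>) < d \<Longrightarrow>
      cmod (\<Psi> z - \<Psi> w - layer_differential v \<zeta> (z - w))
        \<le> e / 2 * ((1 - cmod z) + (1 - cmod w) + cmod (z - w))"
    using strict_differential[OF assms, of "e / 2"] by (metis half_gt_zero)
  have "cmod (\<Psi> y - \<Psi> \<zeta> - layer_differential v \<zeta> (y - \<zeta>)) \<le> e * cmod (y - \<zeta>)"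
    if y: "y \<in> closed_disc" "cmod (y - \<zeta>) < d" for y
  proof -
    have "cmod (\<Psi> y - \<Psi> \<zeta> - layer_differential v \<zeta> (y - \<zeta>))
        \<le> e / 2 * ((1 - cmod y) + (1 - cmod \<zeta>) + cmod (y - \<zeta>))"
      using d y assms by (intro d(2)) auto
    also have "\<dots> \<le> e / 2 * (cmod (y - \<zeta>) + 0 + cmod (y - \<zeta>))"
      using assms norm_triangle_ineq3[of y \<zeta>] \<open>0 < e\<close> by (intro mult_left_mono add_mono) auto
    finally show ?thesis by simp
  qed
  thus "\<exists>d>0. \<forall>y\<in>closed_disc. cmod (y - \<zeta>) < d \<longrightarrow>
      cmod (\<Psi> y - \<Psi> \<zeta> - layer_differential v \<zeta> (y - \<zeta>)) \<le> e * cmod (y - \<zeta>)"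
    using d(1) by blast
qed

lemma boundary_differential_eq:
  assumes "\<zeta> \<in> unit_circ"
  shows "boundary_differential \<Psi> \<zeta> = layer_differential v \<zeta>"
  unfolding boundary_differential_def
  using has_boundary_derivative[OF assms] assms
  by (intro disc_derivative_unique[of \<zeta> \<Psi>] frechet_derivative_works[THEN iffD1])
     (auto simp: differentiable_def)

text \<open>With \<open>x = \<zeta> - t v(\<zeta>)\<close> one has \<open>|x|\<^sup>2 = 1 - 2 t a(\<zeta>) + t\<^sup>2 |v(\<zeta>)|\<^sup>2\<close>, and the value of
  \<open>\<Psi>\<close> differs from \<open>x\<close> by a small multiple of \<open>t\<close>. The denominator \<open>2 t - t\<^sup>2\<close> is at least \<open>t\<close>.\<close>
lemma modulus_quotient:
  assumes \<epsilon>: "0 < \<epsilon>"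
  obtains d where "0 < d" "d \<le> 1" "\<And>t \<zeta>. 0 < t \<Longrightarrow> t < d \<Longrightarrow> \<zeta> \<in> unit_circ \<Longrightarrow>
    \<bar>(1 - (cmod (\<Psi> (of_real (1 - t) * \<zeta>)))\<^sup>2) / (1 - (1 - t)\<^sup>2) - boundary_coeff v \<zeta>\<bar> \<le> \<epsilon>"
proof -
  obtain V where V: "0 \<le> V" "\<And>\<zeta>. \<zeta> \<in> unit_circ \<Longrightarrow> cmod (v \<zeta>) \<le> V" by (rule v_bounded) blast
  define \<epsilon>' where "\<epsilon>' = \<epsilon> / (2 * (2 + V))"
  have \<epsilon>': "0 < \<epsilon>'" using \<epsilon> V by (simp add: \<epsilon>'_def)
  have \<epsilon>'2: "\<epsilon>' * (2 + V) = \<epsilon> / 2" using V by (simp add: \<epsilon>'_def field_simps)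
  obtain d1 where d1: "0 < d1" "d1 \<le> 1" "\<And>t \<zeta>. 0 \<le> t \<Longrightarrow> t < d1 \<Longrightarrow> \<zeta> \<in> unit_circ \<Longrightarrow>
      cmod (\<Psi> (of_real (1 - t) * \<zeta>) - \<zeta> + of_real t * v \<zeta>) \<le> \<epsilon>' * t"
    by (rule expansion_bound[OF \<epsilon>']) blast
  define W where "W = V\<^sup>2 + V + 1"
  define d where "d = min d1 (\<epsilon> / (2 * W))"
  have W: "0 < W" using V by (simp add: W_def add_nonneg_pos)
  have "d \<le> \<epsilon> / (2 * W)" by (simp add: d_def)
  hence dW: "d * (2 * W) \<le> \<epsilon>" using W by (simp add: pos_le_divide_eq)
  have d: "0 < d" "d \<le> d1" using d1(1) \<epsilon> W by (auto simp: d_def)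
  show thesis
  proof (rule that[of d])
    fix t :: real and \<zeta> assume t: "0 < t" "t < d" and \<zeta>: "\<zeta> \<in> unit_circ"
    define a where "a = boundary_coeff v \<zeta>"
    define P where "P = \<Psi> (of_real (1 - t) * \<zeta>)"
    define x where "x = \<zeta> - of_real t * v \<zeta>"
    have t1: "t < 1" using t d d1 by simp
    have \<zeta>1: "cmod \<zeta> = 1" using \<zeta> by simp
    have a: "\<bar>a\<bar> \<le> V"
      using abs_Re_le_cmod[of "cnj \<zeta> * v \<zeta>"] V(2)[OF \<zeta>] \<zeta>1 by (simp add: a_def boundary_coeff_def norm_mult)
    have "cmod (P - \<zeta> + of_real t * v \<zeta>) \<le> \<epsilon>' * t"
      unfolding P_def by (rule d1(3)) (use t d \<zeta> in auto)
    moreover have "P - \<zeta> + of_real t * v \<zeta> = P - x" by (simp add: x_def)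
    ultimately have Px: "cmod (P - x) \<le> \<epsilon>' * t" by simp
    have "of_real (1 - t) * \<zeta> \<in> closed_disc"
      using \<zeta>1 t t1 by (simp add: norm_mult del: of_real_diff)
    hence P1: "cmod P \<le> 1" using maps_closed by (simp add: P_def)
    have x1: "cmod x \<le> 1 + V"
    proof -
      have "cmod x \<le> cmod \<zeta> + t * cmod (v \<zeta>)"
        unfolding x_def using t by (metis abs_of_pos norm_mult norm_of_real norm_triangle_ineq4)
      also have "t * cmod (v \<zeta>) \<le> 1 * V" using t t1 V(2)[OF \<zeta>] by (intro mult_mono) auto
      finally show ?thesis by (simp add: \<zeta>1)
    qed
    have "\<bar>(cmod x)\<^sup>2 - (cmod P)\<^sup>2\<bar> = \<bar>cmod x - cmod P\<bar> * (cmod x + cmod P)"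
      by (simp add: power2_eq_square square_diff_square_factored abs_mult)
    also have "\<dots> \<le> (\<epsilon>' * t) * (2 + V)"
      using norm_triangle_ineq3[of x P] Px x1 P1 \<epsilon>' t
      by (intro mult_mono) (auto simp: norm_minus_commute)
    also have "\<dots> = t * (\<epsilon> / 2)" by (simp only: \<epsilon>'2[symmetric] mult_ac)
    finally have xP: "\<bar>(cmod x)\<^sup>2 - (cmod P)\<^sup>2\<bar> \<le> t * (\<epsilon> / 2)" .
    have zz: "(Re \<zeta>)\<^sup>2 + (Im \<zeta>)\<^sup>2 = 1" using \<zeta>1 cmod_power2[of \<zeta>] by simp
    have "(cmod x)\<^sup>2 = ((Re \<zeta>)\<^sup>2 + (Im \<zeta>)\<^sup>2) - 2 * t * a + t\<^sup>2 * (cmod (v \<zeta>))\<^sup>2"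
      unfolding cmod_power2 by (simp add: x_def a_def boundary_coeff_def power2_eq_square algebra_simps)
    hence x2: "(cmod x)\<^sup>2 = 1 - 2 * t * a + t\<^sup>2 * (cmod (v \<zeta>))\<^sup>2" by (simp only: zz)
    have den: "1 - (1 - t)\<^sup>2 = 2 * t - t\<^sup>2" by (simp add: power2_eq_square algebra_simps)
    have den_ge: "t \<le> 2 * t - t\<^sup>2"
      using mult_left_le[of t t] t t1 by (simp add: power2_eq_square)
    have num: "(1 - (cmod P)\<^sup>2) - (2 * t - t\<^sup>2) * a
        = ((cmod x)\<^sup>2 - (cmod P)\<^sup>2) + (- t\<^sup>2 * (cmod (v \<zeta>))\<^sup>2) + t\<^sup>2 * a"
      unfolding x2 by (simp add: algebra_simps)
    have "\<bar>(1 - (cmod P)\<^sup>2) - (2 * t - t\<^sup>2) * a\<bar>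
        \<le> \<bar>(cmod x)\<^sup>2 - (cmod P)\<^sup>2\<bar> + t\<^sup>2 * (cmod (v \<zeta>))\<^sup>2 + t\<^sup>2 * \<bar>a\<bar>"
      unfolding num
      by (rule order_trans[OF abs_triangle_ineq add_mono[OF order_trans[OF abs_triangle_ineq]]])
         (auto simp: abs_mult)
    also have "\<dots> \<le> t * (\<epsilon> / 2) + t\<^sup>2 * V\<^sup>2 + t\<^sup>2 * V"
      using xP a V(2)[OF \<zeta>] by (intro add_mono mult_left_mono power_mono) auto
    also have "\<dots> = t * (\<epsilon> / 2 + t * (V\<^sup>2 + V))" by (simp add: power2_eq_square algebra_simps)
    also have "\<dots> \<le> t * (\<epsilon> / 2 + \<epsilon> / 2)"
    proof (intro mult_left_mono add_left_mono)
      have "t * (V\<^sup>2 + V) \<le> d * W" using t V by (intro mult_mono) (auto simp: W_def)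
      thus "t * (V\<^sup>2 + V) \<le> \<epsilon> / 2" using dW by simp
    qed (use t in auto)
    also have "\<dots> \<le> (2 * t - t\<^sup>2) * \<epsilon>" using den_ge \<epsilon> by (simp add: mult_right_mono)
    finally have "\<bar>(1 - (cmod P)\<^sup>2) - (2 * t - t\<^sup>2) * a\<bar> \<le> (2 * t - t\<^sup>2) * \<epsilon>" .
    moreover have pos: "0 < 2 * t - t\<^sup>2" using den_ge t by simp
    moreover have "(1 - (cmod P)\<^sup>2) / (2 * t - t\<^sup>2) - a = ((1 - (cmod P)\<^sup>2) - (2 * t - t\<^sup>2) * a) / (2 * t - t\<^sup>2)"
      using pos by (simp add: field_simps)
    ultimately have "\<bar>(1 - (cmod P)\<^sup>2) / (2 * t - t\<^sup>2) - a\<bar> \<le> \<epsilon>"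
      by (simp add: abs_divide pos_divide_le_eq mult.commute)
    thus "\<bar>(1 - (cmod (\<Psi> (of_real (1 - t) * \<zeta>)))\<^sup>2) / (1 - (1 - t)\<^sup>2) - boundary_coeff v \<zeta>\<bar> \<le> \<epsilon>"
      unfolding P_def a_def den .
  qed (use d d1 in auto)
qed

lemma modulus_quotient_limit:
  "((\<lambda>r::real. SUP \<zeta>\<in>unit_circ.
      \<bar>(1 - (cmod (\<Psi> (of_real r * \<zeta>)))\<^sup>2) / (1 - r\<^sup>2) - boundary_coeff v \<zeta>\<bar>) \<longlongrightarrow> 0) (at_left 1)"
  (is "(?S \<longlongrightarrow> 0) _")
proof (rule tendstoI)
  fix e :: real assume e: "0 < e"
  obtain d where d: "0 < d" "\<And>t \<zeta>. 0 < t \<Longrightarrow> t < d \<Longrightarrow> \<zeta> \<in> unit_circ \<Longrightarrow>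
    \<bar>(1 - (cmod (\<Psi> (of_real (1 - t) * \<zeta>)))\<^sup>2) / (1 - (1 - t)\<^sup>2) - boundary_coeff v \<zeta>\<bar> \<le> e / 2"
    by (rule modulus_quotient[of "e / 2"]) (use e in auto)
  have "dist (?S r) 0 < e" if r: "1 - d < r" "r < 1" for r
  proof -
    let ?q = "\<lambda>\<zeta>. \<bar>(1 - (cmod (\<Psi> (of_real r * \<zeta>)))\<^sup>2) / (1 - r\<^sup>2) - boundary_coeff v \<zeta>\<bar>"
    have q: "?q \<zeta> \<le> e / 2" if "\<zeta> \<in> unit_circ" for \<zeta>
      using d(2)[of "1 - r" \<zeta>] r that by simp
    have "?S r \<le> e / 2" by (rule cSUP_least) (use q in auto)
    moreover have "0 \<le> ?S r"
    proof (rule cSUP_upper2[of _ _ 1])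
      show "bdd_above (?q ` unit_circ)" by (rule bdd_aboveI2[OF q])
    qed auto
    ultimately show ?thesis using e by simp
  qed
  thus "\<forall>\<^sub>F r in at_left 1. dist (?S r) 0 < e"
    unfolding eventually_at_left_field using d(1) by (intro exI[of _ "1 - d"]) auto
qed

lemma cont_boundary_coeff: "continuous_on unit_circ (boundary_coeff v)"
  unfolding boundary_coeff_def[abs_def] by (intro continuous_intros cont_v)

lemma boundary_coeff_inf_pos_iff:
  "0 < (INF \<zeta>\<in>unit_circ. boundary_coeff v \<zeta>) \<longleftrightarrow> (\<forall>\<zeta>\<in>unit_circ. 0 < boundary_coeff v \<zeta>)"
proof -
  have ne: "unit_circ \<noteq> {}" by simp
  obtain x where x: "x \<in> unit_circ" "\<And>y. y \<in> unit_circ \<Longrightarrow> boundary_coeff v x \<le> boundary_coeff v y"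
    using continuous_attains_inf[OF _ ne cont_boundary_coeff] by auto
  have "(INF \<zeta>\<in>unit_circ. boundary_coeff v \<zeta>) = boundary_coeff v x"
    by (rule cInf_eq_minimum) (use x in auto)
  thus ?thesis using x by (metis less_le_trans)
qed

lemma polar:
  assumes "z \<noteq> 0"
  shows "of_real (1 - (1 - cmod z)) * sgn z = z" "sgn z \<in> unit_circ"
  using assms by (auto simp: sgn_eq norm_divide)

text \<open>Near the circle this is \<open>modulus_quotient\<close>; on the remaining compact disc the
  continuous function \<open>1 - |\<Psi> z|\<^sup>2\<close> is positive.\<close>
lemma modulus_comparable:
  assumes "\<forall>\<zeta>\<in>unit_circ. 0 < boundary_coeff v \<zeta>"
  obtains c C where "0 < c" "c \<le> C" "\<And>z. z \<in> unit_disc \<Longrightarrow>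
    c * (1 - (cmod z)\<^sup>2) \<le> 1 - (cmod (\<Psi> z))\<^sup>2 \<and> 1 - (cmod (\<Psi> z))\<^sup>2 \<le> C * (1 - (cmod z)\<^sup>2)"
proof -
  have ne: "unit_circ \<noteq> {}" by simp
  obtain x where x: "x \<in> unit_circ" "\<And>y. y \<in> unit_circ \<Longrightarrow> boundary_coeff v x \<le> boundary_coeff v y"
    using continuous_attains_inf[OF _ ne cont_boundary_coeff] by auto
  obtain y where y: "y \<in> unit_circ" "\<And>u. u \<in> unit_circ \<Longrightarrow> boundary_coeff v u \<le> boundary_coeff v y"
    using continuous_attains_sup[OF _ ne cont_boundary_coeff] by auto
  define a A where "a = boundary_coeff v x" and "A = boundary_coeff v y"
  have a: "0 < a" "a \<le> A" using assms x y by (auto simp: a_def A_def)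
  obtain d where d: "0 < d" "d \<le> 1" "\<And>t \<zeta>. 0 < t \<Longrightarrow> t < d \<Longrightarrow> \<zeta> \<in> unit_circ \<Longrightarrow>
    \<bar>(1 - (cmod (\<Psi> (of_real (1 - t) * \<zeta>)))\<^sup>2) / (1 - (1 - t)\<^sup>2) - boundary_coeff v \<zeta>\<bar> \<le> a / 2"
    by (rule modulus_quotient[of "a / 2"]) (use a in auto)
  have sub: "cball 0 (1 - d) \<subseteq> unit_disc" using d by auto
  have "continuous_on (cball 0 (1 - d)) \<Psi>"
    by (rule continuous_on_subset[OF cont]) (use d in auto)
  hence "continuous_on (cball 0 (1 - d)) (\<lambda>z. 1 - (cmod (\<Psi> z))\<^sup>2)" by (intro continuous_intros)
  moreover have "cball (0::complex) (1 - d) \<noteq> {}" using d by simp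
  ultimately obtain u where u: "u \<in> cball 0 (1 - d)"
      "\<And>z. z \<in> cball 0 (1 - d) \<Longrightarrow> 1 - (cmod (\<Psi> u))\<^sup>2 \<le> 1 - (cmod (\<Psi> z))\<^sup>2"
    using continuous_attains_inf[OF compact_cball] by blast
  define m where "m = 1 - (cmod (\<Psi> u))\<^sup>2"
  have m: "0 < m" unfolding m_def by (rule one_minus_cmod_sq_pos[OF maps_disc]) (use u sub in blast)
  define c C where "c = min (a / 2) m" and "C = max (A + a / 2) (1 / d)"
  show thesis
  proof (rule that[of c C])
    show "0 < c" "c \<le> C" using a m by (auto simp: c_def C_def)
    fix z assume z: "z \<in> unit_disc"
    let ?n = "1 - (cmod z)\<^sup>2" and ?p = "1 - (cmod (\<Psi> z))\<^sup>2"
    have n: "0 < ?n" "1 - cmod z \<le> ?n" using one_minus_cmod_sq_pos[OF z] one_minus_cmod_le[of z] z by auto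
    show "c * ?n \<le> ?p \<and> ?p \<le> C * ?n"
    proof (cases "1 - cmod z < d")
      case True
      hence "z \<noteq> 0" using d by auto
      note p = polar[OF this]
      have "\<bar>?p / ?n - boundary_coeff v (sgn z)\<bar> \<le> a / 2"
        using d(3)[of "1 - cmod z" "sgn z"] True z p by simp
      moreover have "a \<le> boundary_coeff v (sgn z)" "boundary_coeff v (sgn z) \<le> A"
        unfolding a_def A_def using x(2) y(2) p(2) by blast+
      ultimately have "a / 2 \<le> ?p / ?n" "?p / ?n \<le> A + a / 2" by linarith+
      hence "c \<le> ?p / ?n" "?p / ?n \<le> C" unfolding c_def C_def by linarith+
      thus ?thesis using n(1) by (simp add: pos_le_divide_eq pos_divide_le_eq)
    next
      case False
      have "c * ?n \<le> m * 1" using m n \<open>0 < c\<close> by (intro mult_mono) (auto simp: c_def)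
      also have "\<dots> \<le> ?p" using u(2)[of z] False by (simp add: m_def)
      finally have 1: "c * ?n \<le> ?p" .
      have "?p \<le> 1 / d * d" using d by simp
      also have "\<dots> \<le> C * ?n" using d n False by (intro mult_mono) (auto simp: C_def le_max_iff_disj)
      finally show ?thesis using 1 by blast
    qed
  qed
qed

lemma displacement:
  obtains K where "0 \<le> K" "\<And>z. z \<in> unit_disc \<Longrightarrow> cmod (z - \<Psi> z) \<le> K * (1 - (cmod z)\<^sup>2)"
proof -
  obtain V where V: "0 \<le> V" "\<And>\<zeta>. \<zeta> \<in> unit_circ \<Longrightarrow> cmod (v \<zeta>) \<le> V" by (rule v_bounded) blast
  obtain d where d: "0 < d" "d \<le> 1" "\<And>t \<zeta>. 0 \<le> t \<Longrightarrow> t < d \<Longrightarrow> \<zeta> \<in> unit_circ \<Longrightarrow>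
      cmod (\<Psi> (of_real (1 - t) * \<zeta>) - \<zeta> + of_real t * v \<zeta>) \<le> 1 * t"
    by (rule expansion_bound[of 1]) auto
  define K where "K = max (V + 2) (2 / d)"
  show thesis
  proof (rule that[of K])
    show "0 \<le> K" using V by (simp add: K_def le_max_iff_disj)
    fix z assume z: "z \<in> unit_disc"
    have n: "1 - cmod z \<le> 1 - (cmod z)\<^sup>2" using one_minus_cmod_le[of z] z by auto
    have "cmod (z - \<Psi> z) \<le> K * (1 - cmod z)"
    proof (cases "1 - cmod z < d")
      case True
      hence z0: "z \<noteq> 0" using d by auto
      define t \<zeta> where "t = 1 - cmod z" and "\<zeta> = sgn z"
      have p: "of_real (1 - t) * \<zeta> = z" "\<zeta> \<in> unit_circ" using polar[OF z0] by (auto simp: t_def \<zeta>_def)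
      have t: "0 \<le> t" "t < d" using z True by (auto simp: t_def)
      define e where "e = \<Psi> z - \<zeta> + of_real t * v \<zeta>"
      have e: "cmod e \<le> t" using d(3)[OF t p(2)] p(1) by (simp add: e_def)
      have "z = \<zeta> - of_real t * \<zeta>" using p(1) by (simp add: algebra_simps)
      hence "z - \<Psi> z = of_real t * v \<zeta> - of_real t * \<zeta> - e" by (simp add: e_def)
      hence "cmod (z - \<Psi> z) \<le> cmod (of_real t * v \<zeta>) + cmod (of_real t * \<zeta>) + cmod e"
        using norm_triangle_ineq4[of "of_real t * v \<zeta> - of_real t * \<zeta>" e]
          norm_triangle_ineq4[of "of_real t * v \<zeta>" "of_real t * \<zeta>"] by simp
      also have "\<dots> \<le> t * V + t + t"
        using e t p(2) V(2)[OF p(2)] by (intro add_mono) (auto simp: norm_mult mult_left_mono)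
      also have "\<dots> = (V + 2) * t" by (simp add: algebra_simps)
      also have "\<dots> \<le> K * t" using t by (intro mult_right_mono) (auto simp: K_def)
      finally show ?thesis by (simp add: t_def)
    next
      case False
      have "cmod (z - \<Psi> z) \<le> 1 + 1"
        using z maps_disc[OF z] by (intro norm_triangle_ineq4[THEN order_trans] add_mono) auto
      also have "\<dots> = 2 / d * d" using d by simp
      also have "\<dots> \<le> K * (1 - cmod z)" using d False by (intro mult_mono) (auto simp: K_def le_max_iff_disj)
      finally show ?thesis .
    qed
    also have "\<dots> \<le> K * (1 - (cmod z)\<^sup>2)" using n \<open>0 \<le> K\<close> by (rule mult_left_mono)
    finally show "cmod (z - \<Psi> z) \<le> K * (1 - (cmod z)\<^sup>2)" .
  qed
qed

text \<open>As \<open>1 - |w| \<le> (1 - |z|) + |z - w|\<close>, the error can be measured at the scale of \<open>z\<close>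
  alone.\<close>
lemma strict_differential_disc:
  assumes \<zeta>: "\<zeta>\<^sub>0 \<in> unit_circ" and \<epsilon>: "0 < \<epsilon>"
  obtains d where "0 < d" "\<And>z w. z \<in> unit_disc \<Longrightarrow> w \<in> unit_disc \<Longrightarrow>
    cmod (z - \<zeta>\<^sub>0) < d \<Longrightarrow> cmod (z - w) < d \<Longrightarrow>
    cmod (\<Psi> z - \<Psi> w - layer_differential v \<zeta>\<^sub>0 (z - w))
      \<le> \<epsilon> * (2 * (1 - (cmod z)\<^sup>2) + 2 * cmod (z - w))"
proof -
  obtain d where d: "0 < d" "\<And>z w. z \<in> closed_disc \<Longrightarrow> w \<in> closed_disc \<Longrightarrow>
    cmod (z - \<zeta>\<^sub>0) < d \<Longrightarrow> cmod (w - \<zeta>\<^sub>0) < d \<Longrightarrow>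
    cmod (\<Psi> z - \<Psi> w - layer_differential v \<zeta>\<^sub>0 (z - w))
      \<le> \<epsilon> * ((1 - cmod z) + (1 - cmod w) + cmod (z - w))"
    by (rule strict_differential[OF assms]) blast
  show thesis
  proof (rule that[of "d / 2"])
    fix z w assume z: "z \<in> unit_disc" and w: "w \<in> unit_disc"
      and *: "cmod (z - \<zeta>\<^sub>0) < d / 2" "cmod (z - w) < d / 2"
    have "cmod (w - \<zeta>\<^sub>0) < d"
      using * norm_triangle_ineq4[of "z - \<zeta>\<^sub>0" "z - w"] by simp
    moreover have "cmod (z - \<zeta>\<^sub>0) < d" using *(1) d(1) by linarith
    ultimately have "cmod (\<Psi> z - \<Psi> w - layer_differential v \<zeta>\<^sub>0 (z - w))
        \<le> \<epsilon> * ((1 - cmod z) + (1 - cmod w) + cmod (z - w))"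
      using z w by (intro d(2)) auto
    also have "\<dots> \<le> \<epsilon> * (2 * (1 - (cmod z)\<^sup>2) + 2 * cmod (z - w))"
      using \<epsilon> z one_minus_cmod_le[of z] norm_triangle_ineq2[of z w]
      by (intro mult_left_mono) auto
    finally show "cmod (\<Psi> z - \<Psi> w - layer_differential v \<zeta>\<^sub>0 (z - w))
      \<le> \<epsilon> * (2 * (1 - (cmod z)\<^sup>2) + 2 * cmod (z - w))" .
  qed (use d in auto)
qed

text \<open>Near a boundary point the differential is bounded, so strict differentiability gives a
  Lipschitz estimate up to an error that is a small multiple of \<open>1 - |z|\<^sup>2\<close>.\<close>
lemma image_close_if_close:
  assumes "0 < \<epsilon>"
  shows "\<exists>\<delta>>0. \<forall>z\<in>unit_disc. \<forall>w\<in>unit_disc. cmod (z - w) \<le> \<delta> * (1 - (cmod z)\<^sup>2) \<longrightarrow>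
    cmod (\<Psi> z - \<Psi> w) \<le> \<epsilon> * (1 - (cmod z)\<^sup>2)"
proof (rule disc_to_boundary_estimate[OF _ _ assms])
  fix e :: real assume e: "0 < e"
  have "uniformly_continuous_on closed_disc \<Psi>"
    by (intro compact_uniformly_continuous cont compact_cball)
  then obtain d where d: "0 < d" "\<And>z w. z \<in> closed_disc \<Longrightarrow> w \<in> closed_disc \<Longrightarrow>
      dist w z < d \<Longrightarrow> dist (\<Psi> w) (\<Psi> z) < e"
    using e unfolding uniformly_continuous_on_def by meson
  show "\<exists>\<delta>>0. \<forall>z\<in>unit_disc. \<forall>w\<in>unit_disc. cmod (z - w) \<le> \<delta> \<longrightarrow> cmod (\<Psi> z - \<Psi> w) \<le> e"
  proof (intro exI[of _ "d / 2"] conjI ballI impI)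
    fix z w assume "z \<in> unit_disc" "w \<in> unit_disc" "cmod (z - w) \<le> d / 2"
    thus "cmod (\<Psi> z - \<Psi> w) \<le> e" using d(1) d(2)[of w z] by (simp add: dist_norm)
  qed (use d in auto)
next
  fix \<zeta> assume \<zeta>: "\<zeta> \<in> unit_circ"
  define L where "L = 1 + cmod (v \<zeta> - \<zeta>)"
  have L: "0 < L" by (simp add: L_def add_pos_nonneg)
  obtain d where d: "0 < d" "\<And>z w. z \<in> unit_disc \<Longrightarrow> w \<in> unit_disc \<Longrightarrow>
      cmod (z - \<zeta>) < d \<Longrightarrow> cmod (z - w) < d \<Longrightarrow>
      cmod (\<Psi> z - \<Psi> w - layer_differential v \<zeta> (z - w))
        \<le> \<epsilon> / 4 * (2 * (1 - (cmod z)\<^sup>2) + 2 * cmod (z - w))"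
    by (rule strict_differential_disc[OF \<zeta>, of "\<epsilon> / 4"]) (use assms in auto)
  define \<delta> where "\<delta> = min (d / 2) (\<epsilon> / (2 * (L + \<epsilon>)))"
  have "\<delta> \<le> \<epsilon> / (2 * (L + \<epsilon>))" by (simp add: \<delta>_def)
  hence "\<delta> * (2 * (L + \<epsilon>)) \<le> \<epsilon>" using L assms by (simp add: pos_le_divide_eq)
  moreover have \<delta>: "0 < \<delta>" "\<delta> \<le> d / 2"
    using d(1) L assms unfolding \<delta>_def by (simp, intro min.cobounded1)
  moreover have "0 < \<delta> * \<epsilon>" using \<delta> assms by simp
  ultimately have \<delta>\<epsilon>: "\<delta> * (L + \<epsilon> / 2) \<le> \<epsilon> / 2" by (simp add: algebra_simps)
  show "\<exists>d>0. \<exists>\<delta>>0. \<forall>z\<in>unit_disc. \<forall>w\<in>unit_disc. cmod (z - \<zeta>) < d \<longrightarrow>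
      cmod (z - w) \<le> \<delta> * (1 - (cmod z)\<^sup>2) \<longrightarrow> cmod (\<Psi> z - \<Psi> w) \<le> \<epsilon> * (1 - (cmod z)\<^sup>2)"
  proof (rule exI[of _ d], rule conjI[OF d(1)], rule exI[of _ \<delta>], intro conjI ballI impI \<delta>(1))
    fix z w assume z: "z \<in> unit_disc" and w: "w \<in> unit_disc" and zd: "cmod (z - \<zeta>) < d"
      and zw: "cmod (z - w) \<le> \<delta> * (1 - (cmod z)\<^sup>2)"
    let ?n = "1 - (cmod z)\<^sup>2" and ?D = "layer_differential v \<zeta> (z - w)"
    have n: "0 < ?n" "?n \<le> 1" using one_minus_cmod_sq_pos[OF z] by auto
    have "\<delta> * ?n \<le> \<delta>" using n \<delta>(1) by (intro mult_left_le) auto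
    hence "cmod (z - w) \<le> \<delta>" using zw by linarith
    hence "cmod (\<Psi> z - \<Psi> w - ?D) \<le> \<epsilon> / 4 * (2 * ?n + 2 * cmod (z - w))"
      using \<delta> d(1) by (intro d(2) z w zd) simp
    moreover have "cmod ?D \<le> L * cmod (z - w)"
      unfolding L_def by (rule layer_differential_upper) (use \<zeta> in simp)
    moreover have "cmod (\<Psi> z - \<Psi> w) \<le> cmod (\<Psi> z - \<Psi> w - ?D) + cmod ?D"
      using norm_triangle_ineq[of "\<Psi> z - \<Psi> w - ?D" ?D] by simp
    ultimately have "cmod (\<Psi> z - \<Psi> w) \<le> \<epsilon> / 2 * ?n + (L + \<epsilon> / 2) * cmod (z - w)"
      by (simp add: algebra_simps)
    also have "\<dots> \<le> \<epsilon> / 2 * ?n + (L + \<epsilon> / 2) * (\<delta> * ?n)"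
      using zw L assms by (intro add_left_mono mult_left_mono) auto
    also have "\<dots> = (\<epsilon> / 2 + \<delta> * (L + \<epsilon> / 2)) * ?n" by (simp add: algebra_simps)
    also have "\<dots> \<le> (\<epsilon> / 2 + \<epsilon> / 2) * ?n" using n \<delta>\<epsilon> by (intro mult_right_mono add_left_mono) auto
    finally show "cmod (\<Psi> z - \<Psi> w) \<le> \<epsilon> * ?n" by simp
  qed
qed

text \<open>Near a boundary point, invertibility of the differential bounds \<open>|z - w|\<close> by a multiple
  \<open>M\<close> of \<open>|\<Psi> z - \<Psi> w|\<close> plus the error term. With \<open>4 M \<epsilon>' \<le> 1\<close>, the part of the error that
  contains \<open>|z - w|\<close> is absorbed into the left-hand side.\<close>
lemma close_if_image_close:
  assumes pos: "\<forall>\<zeta>\<in>unit_circ. 0 < boundary_coeff v \<zeta>" and "0 < \<epsilon>"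
  shows "\<exists>\<delta>>0. \<forall>z\<in>unit_disc. \<forall>w\<in>unit_disc. cmod (\<Psi> z - \<Psi> w) \<le> \<delta> * (1 - (cmod z)\<^sup>2) \<longrightarrow>
    cmod (z - w) \<le> \<epsilon> * (1 - (cmod z)\<^sup>2)"
proof -
  obtain \<Psi>' where \<Psi>': "homeomorphism closed_disc closed_disc \<Psi> \<Psi>'" using homeo by blast
  have "uniformly_continuous_on closed_disc \<Psi>'"
    by (intro compact_uniformly_continuous homeomorphism_cont2[OF \<Psi>'] compact_cball)
  hence unif: "\<exists>\<delta>>0. \<forall>z\<in>unit_disc. \<forall>w\<in>unit_disc. cmod (\<Psi> z - \<Psi> w) \<le> \<delta> \<longrightarrow> cmod (z - w) \<le> e"
    if e: "0 < e" for e
  proof -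
    obtain d where d: "0 < d" "\<And>z w. z \<in> closed_disc \<Longrightarrow> w \<in> closed_disc \<Longrightarrow>
        dist w z < d \<Longrightarrow> dist (\<Psi>' w) (\<Psi>' z) < e"
      using \<open>uniformly_continuous_on closed_disc \<Psi>'\<close> e unfolding uniformly_continuous_on_def by meson
    show ?thesis
    proof (intro exI[of _ "d / 2"] conjI ballI impI)
      fix z w assume "z \<in> unit_disc" "w \<in> unit_disc" and zw: "cmod (\<Psi> z - \<Psi> w) \<le> d / 2"
      hence D: "z \<in> closed_disc" "w \<in> closed_disc" by auto
      have "dist (\<Psi>' (\<Psi> z)) (\<Psi>' (\<Psi> w)) < e"
        using d(1) zw by (intro d(2) maps_closed D) (simp add: dist_norm)
      thus "cmod (z - w) \<le> e"
        using homeomorphism_apply1[OF \<Psi>' D(1)] homeomorphism_apply1[OF \<Psi>' D(2)] by (simp add: dist_norm)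
    qed (use d in auto)
  qed
  show ?thesis
  proof (rule disc_to_boundary_estimate[OF unif _ assms(2)])
    fix \<zeta> assume \<zeta>: "\<zeta> \<in> unit_circ"
    have a: "0 < boundary_coeff v \<zeta>" using pos \<zeta> by blast
    define M where "M = 1 + cmod (v \<zeta> - \<zeta>) / boundary_coeff v \<zeta>"
    have M: "0 < M" using a by (simp add: M_def add_pos_nonneg)
    define \<epsilon>' where "\<epsilon>' = min (1 / (4 * M)) (\<epsilon> / (8 * M))"
    have \<epsilon>': "0 < \<epsilon>'" using M assms(2) by (simp add: \<epsilon>'_def)
    have "\<epsilon>' \<le> 1 / (4 * M)" "\<epsilon>' \<le> \<epsilon> / (8 * M)" by (simp_all add: \<epsilon>'_def)
    hence M\<epsilon>': "4 * (M * \<epsilon>') \<le> 1" "8 * (M * \<epsilon>') \<le> \<epsilon>"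
      using M by (simp_all add: pos_le_divide_eq mult_ac)
    obtain d where d: "0 < d" "\<And>z w. z \<in> unit_disc \<Longrightarrow> w \<in> unit_disc \<Longrightarrow>
        cmod (z - \<zeta>) < d \<Longrightarrow> cmod (z - w) < d \<Longrightarrow>
        cmod (\<Psi> z - \<Psi> w - layer_differential v \<zeta> (z - w))
          \<le> \<epsilon>' * (2 * (1 - (cmod z)\<^sup>2) + 2 * cmod (z - w))"
      by (rule strict_differential_disc[OF \<zeta> \<epsilon>']) blast
    have "0 < d / 2" using d(1) by simp
    from unif[OF this] obtain \<delta>' where \<delta>': "0 < \<delta>'" "\<And>z w. z \<in> unit_disc \<Longrightarrow> w \<in> unit_disc \<Longrightarrow>
        cmod (\<Psi> z - \<Psi> w) \<le> \<delta>' \<Longrightarrow> cmod (z - w) \<le> d / 2"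
      by blast
    define \<delta> where "\<delta> = min \<delta>' (\<epsilon> / (4 * M))"
    have "\<delta> \<le> \<epsilon> / (4 * M)" by (simp add: \<delta>_def)
    hence \<delta>M: "4 * (M * \<delta>) \<le> \<epsilon>" using M by (simp add: pos_le_divide_eq mult_ac)
    have \<delta>: "0 < \<delta>" "\<delta> \<le> \<delta>'" using \<delta>'(1) M assms(2) by (auto simp: \<delta>_def)
    show "\<exists>d>0. \<exists>\<delta>>0. \<forall>z\<in>unit_disc. \<forall>w\<in>unit_disc. cmod (z - \<zeta>) < d \<longrightarrow>
        cmod (\<Psi> z - \<Psi> w) \<le> \<delta> * (1 - (cmod z)\<^sup>2) \<longrightarrow> cmod (z - w) \<le> \<epsilon> * (1 - (cmod z)\<^sup>2)"
    proof (rule exI[of _ d], rule conjI[OF d(1)], rule exI[of _ \<delta>], intro conjI ballI impI \<delta>(1))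
      fix z w assume z: "z \<in> unit_disc" and w: "w \<in> unit_disc" and zd: "cmod (z - \<zeta>) < d"
        and zw: "cmod (\<Psi> z - \<Psi> w) \<le> \<delta> * (1 - (cmod z)\<^sup>2)"
      let ?n = "1 - (cmod z)\<^sup>2" and ?D = "layer_differential v \<zeta> (z - w)"
      have n: "0 < ?n" "?n \<le> 1" using one_minus_cmod_sq_pos[OF z] by auto
      have "\<delta> * ?n \<le> \<delta>" using n \<delta>(1) by (intro mult_left_le) auto
      hence "cmod (\<Psi> z - \<Psi> w) \<le> \<delta>" using zw by linarith
      hence "cmod (z - w) \<le> d / 2" using \<delta>(2) by (intro \<delta>'(2) z w) simp
      hence "cmod (\<Psi> z - \<Psi> w - ?D) \<le> \<epsilon>' * (2 * ?n + 2 * cmod (z - w))"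
        using d(1) by (intro d(2) z w zd) simp
      moreover have "cmod ?D \<le> cmod (\<Psi> z - \<Psi> w) + cmod (\<Psi> z - \<Psi> w - ?D)"
        using norm_triangle_ineq4[of "\<Psi> z - \<Psi> w" "\<Psi> z - \<Psi> w - ?D"] by simp
      ultimately have D: "cmod ?D \<le> \<delta> * ?n + \<epsilon>' * (2 * ?n + 2 * cmod (z - w))"
        using zw by linarith
      have "cmod (z - w) \<le> M * cmod ?D"
        unfolding M_def by (rule layer_differential_lower) (use \<zeta> a in auto)
      also have "\<dots> \<le> M * (\<delta> * ?n + \<epsilon>' * (2 * ?n + 2 * cmod (z - w)))"
        using D M by (intro mult_left_mono) auto
      also have "\<dots> = (M * \<delta> + 2 * (M * \<epsilon>')) * ?n + 2 * (M * \<epsilon>') * cmod (z - w)"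
        by (simp add: algebra_simps)
      also have "\<dots> \<le> (\<epsilon> / 4 + \<epsilon> / 4) * ?n + 1 / 2 * cmod (z - w)"
        using M\<epsilon>' \<delta>M n by (intro add_mono mult_right_mono) auto
      finally show "cmod (z - w) \<le> \<epsilon> * ?n" by simp
    qed
  qed
qed

text \<open>The pseudohyperbolic distance is comparable to \<open>|z - w| / (1 - |z|\<^sup>2)\<close> when either
  quantity is small. As \<open>\<Psi>\<close> changes the scale \<open>1 - |z|\<^sup>2\<close> only by a bounded factor, the two
  closeness lemmas become the separation hypotheses of \<open>carleson_seq_bounded_displacement\<close>.\<close>
proposition in_K_class:
  assumes pos: "\<forall>\<zeta>\<in>unit_circ. 0 < boundary_coeff v \<zeta>" and \<Phi>: "\<And>z. z \<in> unit_disc \<Longrightarrow> \<Phi> z = \<Psi> z"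
  shows "\<Phi> \<in> K_class"
proof -
  obtain c C where cC: "0 < c" "c \<le> C"
    and c: "\<And>z. z \<in> unit_disc \<Longrightarrow> c * (1 - (cmod z)\<^sup>2) \<le> 1 - (cmod (\<Psi> z))\<^sup>2"
    and C: "\<And>z. z \<in> unit_disc \<Longrightarrow> 1 - (cmod (\<Psi> z))\<^sup>2 \<le> C * (1 - (cmod z)\<^sup>2)"
    using modulus_comparable[OF pos] by metis
  obtain K where K: "0 \<le> K" "\<And>z. z \<in> unit_disc \<Longrightarrow> cmod (z - \<Psi> z) \<le> K * (1 - (cmod z)\<^sup>2)"
    by (rule displacement) blast
  have close: "disc_close (max K (K / c)) z (\<Psi> z)" if z: "z \<in> unit_disc" for z
    unfolding disc_close_def
  proof
    show "cmod (z - \<Psi> z) \<le> max K (K / c) * (1 - (cmod z)\<^sup>2)"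
      using one_minus_cmod_sq_pos[OF z]
      by (intro order_trans[OF K(2)[OF z]] mult_right_mono) auto
    have "K * (1 - (cmod z)\<^sup>2) = K / c * (c * (1 - (cmod z)\<^sup>2))" using cC by simp
    also have "\<dots> \<le> K / c * (1 - (cmod (\<Psi> z))\<^sup>2)" using c[OF z] K cC by (intro mult_left_mono) auto
    also have "\<dots> \<le> max K (K / c) * (1 - (cmod (\<Psi> z))\<^sup>2)"
      using one_minus_cmod_sq_pos[OF maps_disc[OF z]] by (intro mult_right_mono) auto
    finally show "cmod (z - \<Psi> z) \<le> max K (K / c) * (1 - (cmod (\<Psi> z))\<^sup>2)" using K(2)[OF z] by simp
  qed
  have sep: "\<exists>\<delta>>0. \<forall>z\<in>unit_disc. \<forall>w\<in>unit_disc. \<epsilon> \<le> pdist z w \<longrightarrow> \<delta> \<le> pdist (\<Psi> z) (\<Psi> w)"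
    if \<epsilon>: "0 < \<epsilon>" for \<epsilon>
  proof -
    obtain \<eta> where \<eta>: "0 < \<eta>" "\<And>z w. z \<in> unit_disc \<Longrightarrow> w \<in> unit_disc \<Longrightarrow>
        cmod (\<Psi> z - \<Psi> w) \<le> \<eta> * (1 - (cmod z)\<^sup>2) \<Longrightarrow> cmod (z - w) \<le> \<epsilon> / 4 * (1 - (cmod z)\<^sup>2)"
      using close_if_image_close[OF pos, of "\<epsilon> / 4"] \<epsilon> by (auto simp del: mem_ball_0)
    define \<delta> where "\<delta> = min (1 / 2) (\<eta> / (2 * C))"
    have \<delta>: "0 < \<delta>" "\<delta> \<le> 1 / 2" using \<eta>(1) cC by (auto simp: \<delta>_def)
    have "\<delta> \<le> \<eta> / (2 * C)" by (simp add: \<delta>_def)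
    hence \<delta>C: "2 * \<delta> * C \<le> \<eta>" using cC by (simp add: pos_le_divide_eq mult_ac)
    have "pdist z w < \<epsilon>" if z: "z \<in> unit_disc" and w: "w \<in> unit_disc" and p: "pdist (\<Psi> z) (\<Psi> w) < \<delta>" for z w
    proof -
      have "cmod (\<Psi> z - \<Psi> w) \<le> 2 * pdist (\<Psi> z) (\<Psi> w) * (1 - (cmod (\<Psi> z))\<^sup>2)"
        using p \<delta> by (intro cmod_diff_le_pdist maps_disc z w) simp
      also have "\<dots> \<le> (2 * \<delta>) * (C * (1 - (cmod z)\<^sup>2))"
        using p \<delta> C[OF z] one_minus_cmod_sq_pos[OF maps_disc[OF z]] by (intro mult_mono) auto
      also have "\<dots> = 2 * \<delta> * C * (1 - (cmod z)\<^sup>2)" by simp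
      also have "\<dots> \<le> \<eta> * (1 - (cmod z)\<^sup>2)"
        using \<delta>C one_minus_cmod_sq_pos[OF z] by (intro mult_right_mono) auto
      finally have "cmod (z - w) \<le> \<epsilon> / 4 * (1 - (cmod z)\<^sup>2)" by (rule \<eta>(2)[OF z w])
      hence "pdist z w * (1 - (cmod z)\<^sup>2) \<le> \<epsilon> / 2 * (1 - (cmod z)\<^sup>2)"
        using pdist_mult_le[OF z w] by simp
      hence "pdist z w \<le> \<epsilon> / 2" using one_minus_cmod_sq_pos[OF z] by (simp only: mult_le_cancel_right_pos)
      thus ?thesis using \<epsilon> by simp
    qed
    thus ?thesis using \<delta>(1) by (meson linorder_not_le)
  qed
  have sep': "\<exists>\<delta>>0. \<forall>z\<in>unit_disc. \<forall>w\<in>unit_disc. \<epsilon> \<le> pdist (\<Psi> z) (\<Psi> w) \<longrightarrow> \<delta> \<le> pdist z w"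
    if \<epsilon>: "0 < \<epsilon>" for \<epsilon>
  proof -
    define \<kappa> where "\<kappa> = \<epsilon> * c / 4"
    have "0 < \<kappa>" using \<epsilon> cC by (simp add: \<kappa>_def)
    from image_close_if_close[OF this]
    obtain \<eta> where \<eta>: "0 < \<eta>" "\<And>z w. z \<in> unit_disc \<Longrightarrow> w \<in> unit_disc \<Longrightarrow>
        cmod (z - w) \<le> \<eta> * (1 - (cmod z)\<^sup>2) \<Longrightarrow> cmod (\<Psi> z - \<Psi> w) \<le> \<kappa> * (1 - (cmod z)\<^sup>2)"
      by blast
    define \<delta> where "\<delta> = min (1 / 2) (\<eta> / 2)"
    have \<delta>: "0 < \<delta>" "\<delta> \<le> 1 / 2" "2 * \<delta> \<le> \<eta>" using \<eta>(1) by (auto simp: \<delta>_def)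
    have "pdist (\<Psi> z) (\<Psi> w) < \<epsilon>" if z: "z \<in> unit_disc" and w: "w \<in> unit_disc" and p: "pdist z w < \<delta>" for z w
    proof -
      let ?n = "1 - (cmod (\<Psi> z))\<^sup>2"
      have "cmod (z - w) \<le> 2 * pdist z w * (1 - (cmod z)\<^sup>2)"
        using p \<delta> by (intro cmod_diff_le_pdist z w) simp
      also have "\<dots> \<le> \<eta> * (1 - (cmod z)\<^sup>2)"
        using p \<delta> one_minus_cmod_sq_pos[OF z] by (intro mult_right_mono) auto
      finally have "cmod (\<Psi> z - \<Psi> w) \<le> \<kappa> * (1 - (cmod z)\<^sup>2)" by (rule \<eta>(2)[OF z w])
      also have "\<dots> = \<epsilon> / 4 * (c * (1 - (cmod z)\<^sup>2))" by (simp add: \<kappa>_def)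
      also have "\<dots> \<le> \<epsilon> / 4 * ?n" using c[OF z] \<epsilon> by (intro mult_left_mono) auto
      finally have "pdist (\<Psi> z) (\<Psi> w) * ?n \<le> \<epsilon> / 2 * ?n"
        using pdist_mult_le[OF maps_disc[OF z] maps_disc[OF w]] by simp
      hence "pdist (\<Psi> z) (\<Psi> w) \<le> \<epsilon> / 2"
        using one_minus_cmod_sq_pos[OF maps_disc[OF z]] by (simp only: mult_le_cancel_right_pos)
      thus ?thesis using \<epsilon> by simp
    qed
    thus ?thesis using \<delta>(1) by (meson linorder_not_le)
  qed
  have "carleson_seq I lam \<longleftrightarrow> carleson_seq I (\<lambda>j. \<Phi> (lam j))" if "lam ` I \<subseteq> unit_disc" for I lam
    by (rule carleson_seq_bounded_displacement[of \<Phi> "max K (K / c)"])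
       (use that sep sep' close maps_disc \<Phi> K(1) in \<open>auto simp: le_max_iff_disj simp del: mem_ball_0\<close>)
  moreover have "continuous_on unit_disc \<Phi>"
  proof -
    have "continuous_on unit_disc \<Psi>" by (rule continuous_on_subset[OF cont]) auto
    thus ?thesis by (rule continuous_on_eq) (simp add: \<Phi>)
  qed
  moreover have "\<Phi> ` unit_disc \<subseteq> unit_disc" using \<Phi> maps_disc by auto
  ultimately have "\<Phi> \<in> carleson_biinvariant" by (auto simp: carleson_biinvariant_def simp del: mem_ball_0)
  moreover have "\<forall>z\<in>unit_disc. c * (1 - (cmod z)\<^sup>2) \<le> 1 - (cmod (\<Phi> z))\<^sup>2 \<and>
      1 - (cmod (\<Phi> z))\<^sup>2 \<le> C * (1 - (cmod z)\<^sup>2)"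
    using c C \<Phi> by simp
  ultimately have "\<Phi> \<in> P_class" using cC unfolding P_class_def by blast
  moreover have "disc_extension \<Phi> \<Psi>" using homeo \<Phi> by (auto simp: disc_extension_def)
  ultimately show ?thesis using bdry unfolding K_class_def by blast
qed

text \<open>The quotient that tends to \<open>a(\<zeta>)\<close> is bounded below by the constant \<open>c\<close> from the
  definition of the class.\<close>
lemma boundary_coeff_pos_if_P_class:
  assumes "\<Phi> \<in> P_class" and \<Phi>: "\<And>z. z \<in> unit_disc \<Longrightarrow> \<Phi> z = \<Psi> z" and \<zeta>: "\<zeta> \<in> unit_circ"
  shows "0 < boundary_coeff v \<zeta>"
proof -
  obtain c where c: "0 < c" "\<And>z. z \<in> unit_disc \<Longrightarrow> c * (1 - (cmod z)\<^sup>2) \<le> 1 - (cmod (\<Phi> z))\<^sup>2"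
    using assms(1) unfolding P_class_def by blast
  obtain d where d: "0 < d" "d \<le> 1" "\<And>t \<zeta>. 0 < t \<Longrightarrow> t < d \<Longrightarrow> \<zeta> \<in> unit_circ \<Longrightarrow>
    \<bar>(1 - (cmod (\<Psi> (of_real (1 - t) * \<zeta>)))\<^sup>2) / (1 - (1 - t)\<^sup>2) - boundary_coeff v \<zeta>\<bar> \<le> c / 2"
    by (rule modulus_quotient[of "c / 2"]) (use c in auto)
  define t where "t = d / 2"
  define z where "z = of_real (1 - t) * \<zeta>"
  have t: "0 < t" "t < d" "t < 1" using d by (auto simp: t_def)
  have cz: "cmod z = 1 - t" using \<zeta> t by (simp add: z_def norm_mult del: of_real_diff)
  hence z: "z \<in> unit_disc" using t by simp
  have "c * (1 - (1 - t)\<^sup>2) \<le> 1 - (cmod (\<Psi> z))\<^sup>2" using c(2)[OF z] \<Phi>[OF z] cz by simp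
  hence "c \<le> (1 - (cmod (\<Psi> z))\<^sup>2) / (1 - (1 - t)\<^sup>2)"
    using one_minus_cmod_sq_pos[OF z] cz by (simp add: pos_le_divide_eq)
  thus ?thesis using d(3)[OF t(1,2) \<zeta>] c(1) unfolding z_def[symmetric] by linarith
qed

end

section \<open>Characterisation by the boundary differential\<close>

theorem theorem3p8:
  fixes \<Psi> v :: "complex \<Rightarrow> complex"
  assumes homeo: "\<exists>\<Psi>'. homeomorphism closed_disc closed_disc \<Psi> \<Psi>'"
    and bdry: "\<forall>\<zeta>\<in>unit_circ. \<Psi> \<zeta> = \<zeta>"
    and expansion: "uniform_boundary_expansion \<Psi> v"
  shows "(\<forall>\<zeta>\<in>unit_circ. \<Psi> differentiable (at \<zeta> within closed_disc) \<and>
           (\<forall>h. boundary_differential \<Psi> \<zeta> h = h + of_real (Re (cnj \<zeta> * h)) * (v \<zeta> - \<zeta>))) \<and>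
         (restrict \<Psi> unit_disc \<in> K_class \<longleftrightarrow> (INF \<zeta>\<in>unit_circ. boundary_coeff v \<zeta>) > 0) \<and>
         ((INF \<zeta>\<in>unit_circ. boundary_coeff v \<zeta>) > 0 \<longleftrightarrow>
           (\<forall>\<zeta>\<in>unit_circ. real_det (boundary_differential \<Psi> \<zeta>) > 0)) \<and>
         ((\<lambda>r::real. SUP \<zeta>\<in>unit_circ.
             \<bar>(1 - (cmod (\<Psi> (of_real r * \<zeta>)))\<^sup>2) / (1 - r\<^sup>2) - boundary_coeff v \<zeta>\<bar>) \<longlongrightarrow> 0)
           (at_left 1)"
proof -
  interpret boundary_expansion \<Psi> v using assms by unfold_locales
  have restrict: "restrict \<Psi> unit_disc z = \<Psi> z" if "z \<in> unit_disc" for z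
    using that by simp
  have K: "restrict \<Psi> unit_disc \<in> K_class \<longleftrightarrow> (\<forall>\<zeta>\<in>unit_circ. 0 < boundary_coeff v \<zeta>)"
    using in_K_class[OF _ restrict] boundary_coeff_pos_if_P_class[OF _ restrict]
    unfolding K_class_def by blast
  have "real_det (boundary_differential \<Psi> \<zeta>) = boundary_coeff v \<zeta>" if "\<zeta> \<in> unit_circ" for \<zeta>
    using boundary_differential_eq[OF that] real_det_layer_differential[of \<zeta> v] that by simp
  hence det: "(\<forall>\<zeta>\<in>unit_circ. 0 < boundary_coeff v \<zeta>) \<longleftrightarrow>
      (\<forall>\<zeta>\<in>unit_circ. 0 < real_det (boundary_differential \<Psi> \<zeta>))" by simp
  have diff: "\<forall>\<zeta>\<in>unit_circ. \<Psi> differentiable (at \<zeta> within closed_disc) \<and>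
      (\<forall>h. boundary_differential \<Psi> \<zeta> h = h + of_real (Re (cnj \<zeta> * h)) * (v \<zeta> - \<zeta>))"
  proof
    fix \<zeta> assume "\<zeta> \<in> unit_circ"
    from has_boundary_derivative[OF this] boundary_differential_eq[OF this]
    show "\<Psi> differentiable (at \<zeta> within closed_disc) \<and>
        (\<forall>h. boundary_differential \<Psi> \<zeta> h = h + of_real (Re (cnj \<zeta> * h)) * (v \<zeta> - \<zeta>))"
      by (auto simp: differentiable_def layer_differential_def)
  qed
  show ?thesis
    unfolding boundary_coeff_inf_pos_iff by (intro conjI diff K det modulus_quotient_limit)
qed

end
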